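(* Let $0<\alpha<1$, let $A$ be a closed linear operator on a Banach space $X$, and suppose that $A$ generates the $(\alpha,1)$-resolvent family $\{S_{\alpha,1}(t)\}_{t\ge 0}$. Let $x\in X$ and $T>0$ be fixed, and let $u(t;x)=S_{\alpha,1}(t)x$ be the solution of $\partial_t^\alpha u(t)=Au(t)$, $t>0$, $u(0)=x$ (Caputo derivative). Then the order $\alpha$ satisfies $$Tu(T;x)-(g_1\ast u)(T;x)=\alpha\,\varphi_T(x),$$ where $\varphi_t(x):=(S_{\alpha,1}\ast u)(t;x)-(g_1\ast u)(t;x)$.
   Context: Conventions. For $\gamma>0$, $g_\gamma(t):=t^{\gamma-1}/\Gamma(\gamma)$ (so $g_1\equiv 1$). The finite convolution is $(f\ast g)(t):=\int_0^t f(t-s)g(s)\,ds$; thus $(g_1\ast u)(t;x)=\int_0^t u(s;x)\,ds$ and $(S_{\alpha,1}\ast u)(t;x)=\int_0^t S_{\alpha,1}(t-s)u(s;x)\,ds$. For $0<\alpha<1$ the Caputo derivative is $\partial_t^\alpha f(t)=\int_0^t g_{1-\alpha}(t-s)f'(s)\,ds$. Resolvent families. Let $A$ be a closed linear operator on a Banach space $X$ and $\alpha,\beta>0$. $A$ is the generator of an $(\alpha,\beta)$-resolvent family if there exist $\omega\ge 0$ and a strongly continuous function $S_{\alpha,\beta}:(0,\infty)\to\mathcal{B}(X)$ (bounded linear operators on $X$) that is exponentially bounded (there are $M>0$, $w\in\mathbb{R}$ with $\|S_{\alpha,\beta}(t)\|\le Me^{wt}$ for $t>0$), with $\{\lambda^\alpha:\mathrm{Re}\,\lambda>\omega\}\subset\rho(A)$,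 such that for all $x\in X$ and $\mathrm{Re}\,\lambda>\omega$, $\lambda^{\alpha-\beta}(\lambda^\alpha-A)^{-1}x=\int_0^\infty e^{-\lambda t}S_{\alpha,\beta}(t)x\,dt$. Then $\{S_{\alpha,\beta}(t)\}$ is called the $(\alpha,\beta)$-resolvent family generated by $A$. For $\beta=1$, $S_{\alpha,1}(0)=I$. *)

theory Defs
  imports "HOL-Analysis.Analysis"
begin

class complex_normed_vector = real_normed_vector +
  fixes scaleC :: "complex \<Rightarrow> 'a \<Rightarrow> 'a"  (infixr "*\<^sub>C" 75)
  assumes scaleC_add_right: "c *\<^sub>C (x + y) = c *\<^sub>C x + c *\<^sub>C y"
    and scaleC_add_left: "(c + d) *\<^sub>C x = c *\<^sub>C x + d *\<^sub>C x"
    and scaleC_scaleC: "c *\<^sub>C (d *\<^sub>C x) = (c * d) *\<^sub>C x"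
    and scaleR_scaleC: "r *\<^sub>R x = complex_of_real r *\<^sub>C x"
    and norm_scaleC: "norm (c *\<^sub>C x) = cmod c * norm x"

class complex_banach = complex_normed_vector + banach

instantiation complex :: complex_banach
begin
definition "scaleC_complex (c::complex) (x::complex) = c * x"
instance
  by standard (auto simp: scaleC_complex_def algebra_simps norm_mult scaleR_conv_of_real)
end

definition bounded_clinear :: "('a::complex_normed_vector \<Rightarrow> 'a) \<Rightarrow> bool" where
  "bounded_clinear f \<longleftrightarrow> bounded_linear f \<and> (\<forall>c x. f (c *\<^sub>C x) = c *\<^sub>C f x)"

(* An (unbounded) operator is a pair of a domain D and a function A; the values of A
   outside D are never used. The domain need not be dense. *)
definition closed_linear_operator ::
    "'a::complex_normed_vector set \<Rightarrow> ('a \<Rightarrow> 'a) \<Rightarrow> bool" where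
  "closed_linear_operator D A \<longleftrightarrow>
     0 \<in> D \<and>
     (\<forall>x\<in>D. \<forall>y\<in>D. x + y \<in> D \<and> A (x + y) = A x + A y) \<and>
     (\<forall>c. \<forall>x\<in>D. c *\<^sub>C x \<in> D \<and> A (c *\<^sub>C x) = c *\<^sub>C A x) \<and>
     closed ((\<lambda>x. (x, A x)) ` D)"

definition resolvent_op ::
    "'a::complex_normed_vector set \<Rightarrow> ('a \<Rightarrow> 'a) \<Rightarrow> complex \<Rightarrow> 'a \<Rightarrow> 'a" where
  "resolvent_op D A \<mu> = the_inv_into D (\<lambda>x. \<mu> *\<^sub>C x - A x)"

definition resolvent_set ::
    "'a::complex_normed_vector set \<Rightarrow> ('a \<Rightarrow> 'a) \<Rightarrow> complex set" where
  "resolvent_set D A =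
     {\<mu>. bij_betw (\<lambda>x. \<mu> *\<^sub>C x - A x) D UNIV \<and> bounded_clinear (resolvent_op D A \<mu>)}"

(* S is the (\<alpha>,\<beta>)-resolvent family generated by A, for \<alpha>, \<beta> > 0. Strong continuity is
   only required on the open half-line; the last clause fixes the value at 0 for \<beta> = 1.
   Complex powers use the principal branch, which is harmless since Re \<lambda> > \<omega> \<ge> 0.
   The Laplace integral is a Henstock-Kurzweil integral because the library's Bochner
   integral needs a separable space; as S is exponentially bounded and \<omega> may be enlarged,
   this gives the same notion. *)
definition resolvent_family ::
    "real \<Rightarrow> real \<Rightarrow> 'a::complex_banach set \<Rightarrow> ('a \<Rightarrow> 'a) \<Rightarrow> (real \<Rightarrow> 'a \<Rightarrow> 'a) \<Rightarrow> bool" where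
  "resolvent_family \<alpha> \<beta> D A S \<longleftrightarrow>
     (\<forall>t>0. bounded_clinear (S t)) \<and>
     (\<forall>x. continuous_on {0<..} (\<lambda>t. S t x)) \<and>
     (\<exists>M>0. \<exists>w. \<forall>t>0. onorm (S t) \<le> M * exp (w * t)) \<and>
     (\<exists>\<omega>\<ge>0.
        (\<lambda>z. z powr complex_of_real \<alpha>) ` {z. Re z > \<omega>} \<subseteq> resolvent_set D A \<and>
        (\<forall>x z. Re z > \<omega> \<longrightarrow>
           ((\<lambda>t. exp (- z * complex_of_real t) *\<^sub>C S t x) has_integral
              z powr complex_of_real (\<alpha> - \<beta>) *\<^sub>C resolvent_op D A (z powr complex_of_real \<alpha>) x)
             {0..})) \<and>
     (\<beta> = 1 \<longrightarrow> (\<forall>x. S 0 x = x))"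

(* Since 0 powr 0 = 0, g_kernel 1 is 1 only for t > 0; this does not affect convolutions. *)
definition g_kernel :: "real \<Rightarrow> real \<Rightarrow> real" where
  "g_kernel \<gamma> t = t powr (\<gamma> - 1) / Gamma \<gamma>"

definition conv :: "(real \<Rightarrow> real) \<Rightarrow> (real \<Rightarrow> 'a::complex_banach) \<Rightarrow> real \<Rightarrow> 'a" where
  "conv f v t = integral {0..t} (\<lambda>s. f (t - s) *\<^sub>R v s)"

definition op_conv ::
    "(real \<Rightarrow> 'a \<Rightarrow> 'a) \<Rightarrow> (real \<Rightarrow> 'a::complex_banach) \<Rightarrow> real \<Rightarrow> 'a" where
  "op_conv S v t = integral {0..t} (\<lambda>s. S (t - s) (v s))"

(* The orbit u(t;x) = S(t)x solves the Caputo problem of order \<alpha> with initial value x.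
   For arbitrary x it need not be differentiable, so the solution is given by this
   formula and not characterised through the derivative of u. *)
definition solution :: "(real \<Rightarrow> 'a \<Rightarrow> 'a) \<Rightarrow> 'a \<Rightarrow> real \<Rightarrow> 'a::complex_banach" where
  "solution S x t = S t x"

definition phi :: "(real \<Rightarrow> 'a \<Rightarrow> 'a) \<Rightarrow> real \<Rightarrow> 'a \<Rightarrow> 'a::complex_banach" where
  "phi S t x = op_conv S (solution S x) t - conv (g_kernel 1) (solution S x) t"

end

theory Submission
  imports Defs
begin

text \<open>
  Write L for the real Laplace transform of the family. Since L(l) is l^(a-1) (l^a - A)^(-1), where a is
  the order, the resolvent identity gives -L'(l) = ((1 - a) / l) L(l) + a L(l)^2. The left side is the
  transform of t S(t)x, the two summands on the right are those of (1 - a) (g_1 * u) and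
  a (S * u). As all functions involved are continuous on the open half-line, uniqueness of the
  Laplace transform gives T u(T) = (1 - a) (g_1 * u)(T) + a (S * u)(T), which is the claim.

  Laplace integrals are only taken along the real axis. The family may fail to be continuous at 0
  (the domain of A need not be dense), so all integrands are only assumed continuous on the open
  half-line and bounded near 0.
\<close>

text \<open>The formula for -L' is the product rule. Differentiating the power
  \<open>l powr (\<alpha> - 1)\<close> gives the factor (1 - a) / l; differentiating the resolvent
  gives a l^(a-1) times its square, and the extra power completes a second factor L(l). The
  difference quotient is arranged so that \<open>L (l + h)\<close> acts on the fixed vector
  \<open>R l x\<close>. Hence strong continuity from the right suffices, and this again comes from
  the Laplace integral. The iterated transform of S(r)S(s)x is L(l)(L(l)x) because the bounded
  operator L(l) can be pulled out of the integral over s. The integrals are Henstock-Kurzweil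
  integrals of functions that are uncontrolled at end points. Integrability is therefore derived
  from continuity on an open interval together with a bound, and the limits rest on explicit
  estimates with exponential majorants.\<close>

section \<open>Vector-valued integrals and uniqueness of the Laplace transform\<close>

text \<open>The primitive taken from the right end is Lipschitz on the half-open interval, so it
  extends continuously to \<open>a\<close>. The fundamental theorem with derivatives only in the
  interior then yields the integral; the value of \<open>f\<close> at \<open>a\<close> never
  enters.\<close>

lemma integrable_bounded_continuous_Ioc:
  fixes f :: "real \<Rightarrow> 'a::banach"
  assumes "a \<le> b" and cont: "continuous_on {a<..b} f"
    and bound: "\<And>t. t \<in> {a<..b} \<Longrightarrow> norm (f t) \<le> B"
  shows "f integrable_on {a..b}"
proof (cases "a = b")
  case True
  then show ?thesis by (metis box_real(2) integrable_on_refl)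
next
  case False
  with assms have ab: "a < b" by simp
  have B: "B \<ge> 0" using bound[of b] ab by (smt (verit) greaterThanAtMost_iff norm_ge_zero)
  define F where "F t = integral {t..b} f" for t
  have int: "f integrable_on {c..d}" if "a < c" "d \<le> b" for c d
    using that by (intro integrable_continuous_interval continuous_on_subset[OF cont]) auto
  have split: "F c = integral {c..d} f + F d" if "a < c" "c \<le> d" "d \<le> b" for c d
    unfolding F_def using that by (intro Henstock_Kurzweil_Integration.integral_combine[symmetric] int) auto
  have diff: "norm (F d - F c) \<le> B * \<bar>d - c\<bar>" if "a < c" "c \<le> d" "d \<le> b" for c d
  proof -
    have "norm (integral {c..d} f) \<le> B * (d - c)"
      using that by (intro integral_bound continuous_on_subset[OF cont] bound) auto
    then show ?thesis using split[OF that] that by (simp add: norm_minus_commute)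
  qed
  have "B-lipschitz_on {a<..b} F"
  proof (rule lipschitz_onI[OF _ B])
    fix x y assume "x \<in> {a<..b}" "y \<in> {a<..b}"
    then show "dist (F x) (F y) \<le> B * dist x y"
      using diff[of x y] diff[of y x]
      by (cases "x \<le> y") (auto simp: dist_norm norm_minus_commute abs_minus_commute)
  qed
  then obtain g where lip: "B-lipschitz_on (closure {a<..b}) g" and g: "\<And>t. t \<in> {a<..b} \<Longrightarrow> g t = F t"
    using lipschitz_extend_closure by metis
  have "closure {a<..b} = {a..b}" using ab by simp
  then have contg: "continuous_on {a..b} g" using lipschitz_on_continuous_on[OF lip] by simp
  have deriv: "((\<lambda>t. - g t) has_vector_derivative f u) (at u)" if u: "u \<in> {a<..<b}" for u
  proof -
    define c where "c = (a + u) / 2"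
    have c: "a < c" "c < u" using u by (auto simp: c_def)
    have "((\<lambda>t. integral {c..t} f) has_vector_derivative f u) (at u within {c..b})"
      using c u by (intro integral_has_vector_derivative continuous_on_subset[OF cont]) auto
    then have "((\<lambda>t. integral {c..t} f) has_vector_derivative f u) (at u)"
      using c u by (simp add: at_within_Icc_at)
    then have "((\<lambda>t. integral {c..t} f - F c) has_vector_derivative f u) (at u)"
      by (auto intro!: derivative_eq_intros)
    then show ?thesis
    proof (rule has_vector_derivative_transform_within_open)
      show "integral {c..t} f - F c = - g t" if "t \<in> {c<..<b}" for t
        using split[of c t] g[of t] that c by simp
    qed (use c u in auto)
  qed
  have "(f has_integral (- g b - - g a)) {a..b}"
    using deriv contg ab
    by (intro fundamental_theorem_of_calculus_interior_strong[where S = "{}"] continuous_intros) auto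
  then show ?thesis by blast
qed

lemma integrable_bounded_continuous_Ioo:
  fixes f :: "real \<Rightarrow> 'a::banach"
  assumes cont: "continuous_on {a<..<b} f"
    and bound: "\<And>t. t \<in> {a<..<b} \<Longrightarrow> norm (f t) \<le> B"
  shows "f integrable_on {a..b}"
proof (cases "a < b")
  case False
  then show ?thesis
    by (metis box_real(2) integrable_on_refl integrable_on_null content_real_eq_0 linorder_not_less)
next
  case ab: True
  define m where "m = (a + b) / 2"
  have m: "a < m" "m < b" using ab by (auto simp: m_def)
  have 1: "f integrable_on {a..m}"
    using m by (intro integrable_bounded_continuous_Ioc[where B = B] continuous_on_subset[OF cont] bound) auto
  have "(\<lambda>t. f (- t)) integrable_on {-b..-m}"
    using m by (intro integrable_bounded_continuous_Ioc[where B = B] continuous_on_compose2[OF cont] bound)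
      (auto intro!: continuous_intros)
  then have "f integrable_on {m..b}" by (simp add: integrable_reflect_real)
  with 1 m show ?thesis by (meson Henstock_Kurzweil_Integration.integrable_combine less_imp_le)
qed

lemma integrable_exp_decay:
  fixes f :: "real \<Rightarrow> 'a::banach"
  assumes cont: "continuous_on {0<..} f" and "d > 0"
    and bound: "\<And>t. t > 0 \<Longrightarrow> norm (f t) \<le> M * exp (- d * t)"
  shows "f integrable_on {0..}"
proof -
  have fin: "f integrable_on {0..b}" for b
  proof (rule integrable_bounded_continuous_Ioo[where B = "\<bar>M\<bar>"])
    fix t assume t: "t \<in> {0<..<b}"
    have "M * exp (- d * t) \<le> \<bar>M\<bar> * 1" using t \<open>d > 0\<close> by (intro mult_mono) auto
    then show "norm (f t) \<le> \<bar>M\<bar>" using bound[of t] t by auto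
  qed (auto intro: continuous_on_subset[OF cont])
  \<comment> \<open>The decay bound is silent at 0, whereas the comparison test wants it on all of
    \<open>{0..}\<close>.\<close>
  define f' where "f' t = (if t = 0 then 0 else f t)" for t
  have "f' integrable_on {0..}"
  proof (rule integrable_on_all_intervals_integrable_bound)
    show "(\<lambda>t. if t \<in> {0..} then f' t else 0) integrable_on cbox a b" for a b
    proof -
      have "f' integrable_on {0..b}"
        by (rule integrable_spike_finite[OF _ _ fin, where S = "{0}"]) (auto simp: f'_def)
      then have "f' integrable_on {max 0 a..b}" by (rule integrable_on_subinterval) auto
      moreover have "{0..} \<inter> cbox a b = {max 0 a..b}" by auto
      ultimately show ?thesis by (subst integrable_restrict_Int) simp
    qed
    show "(\<lambda>t. \<bar>M\<bar> * exp (- d * t)) integrable_on {0..}"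
      using integrable_on_exp_minus_to_infinity[OF \<open>d > 0\<close>] by (rule integrable_on_mult_right)
    show "norm (f' t) \<le> \<bar>M\<bar> * exp (- d * t)" if "t \<in> {0..}" for t
    proof (cases "t = 0")
      case False
      then have "norm (f t) \<le> M * exp (- d * t)" using bound that by auto
      also have "\<dots> \<le> \<bar>M\<bar> * exp (- d * t)" by (intro mult_right_mono) auto
      finally show ?thesis using False by (simp add: f'_def)
    qed (simp add: f'_def)
  qed
  then show ?thesis
    by (rule integrable_spike_finite[where S = "{0}", rotated 2]) (auto simp: f'_def)
qed

text \<open>The exceptional set absorbs the end points 0 and \<open>t\<close>, where the bounds on
  kernels and orbits say nothing.\<close>

lemma integral_norm_bound_integral_spike_finite:
  fixes f :: "'n::euclidean_space \<Rightarrow> 'a::banach"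
  assumes "f integrable_on S" "g integrable_on S" "finite F"
    and "\<And>x. x \<in> S - F \<Longrightarrow> norm (f x) \<le> g x"
  shows "norm (integral S f) \<le> integral S g"
proof -
  define f' where "f' x = (if x \<in> F then 0 else f x)" for x
  define g' where "g' x = (if x \<in> F then 0 else g x)" for x
  have "norm (integral S f') \<le> integral S g'"
  proof (rule integral_norm_bound_integral)
    show "f' integrable_on S"
      by (rule integrable_spike_finite[OF assms(3) _ assms(1)]) (simp add: f'_def)
    show "g' integrable_on S"
      by (rule integrable_spike_finite[OF assms(3) _ assms(2)]) (simp add: g'_def)
    show "norm (f' x) \<le> g' x" if "x \<in> S" for x
      using assms(4)[of x] that by (simp add: f'_def g'_def)
  qed
  moreover have "integral S f' = integral S f" "integral S g' = integral S g"
    using assms(3) by (auto intro!: integral_spike[OF negligible_finite] simp: f'_def g'_def)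
  ultimately show ?thesis by simp
qed

lemma tendsto_integral_Icc_at_top:
  fixes f :: "real \<Rightarrow> 'a::banach"
  assumes "(f has_integral I) {0..}"
  shows "((\<lambda>R. integral {0..R} f) \<longlongrightarrow> I) at_top"
proof (rule tendstoI)
  fix e :: real assume "e > 0"
  then obtain B where B: "B > 0"
    "\<And>a b. ball 0 B \<subseteq> cbox a b \<Longrightarrow> norm (integral (cbox a b) (\<lambda>t. if t \<in> {0..} then f t else 0) - I) < e"
    using assms unfolding has_integral_alt' by metis
  have "dist (integral {0..R} f) I < e" if "R \<ge> B" for R
  proof -
    have "ball 0 B \<subseteq> cbox (- B) R" using that by (auto simp: dist_norm)
    then have "norm (integral (cbox (- B) R) (\<lambda>t. if t \<in> {0..} then f t else 0) - I) < e"
      by (rule B)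
    moreover have "{0..} \<inter> cbox (- B) R = {0..R}" using B(1) by auto
    ultimately show ?thesis by (simp only: integral_restrict_Int dist_norm)
  qed
  then show "\<forall>\<^sub>F R in at_top. dist (integral {0..R} f) I < e"
    by (rule eventually_at_top_linorderI)
qed

text \<open>
  The transforms at l, l + 1, l + 2, ... are moments of a function of exp (-t), so by Weierstrass the
  function integrates to zero against every continuous function of exp (-t), in particular against a
  tent around exp (-t0). This avoids the Hahn-Banach theorem.
\<close>

lemma laplace_unique:
  fixes h :: "real \<Rightarrow> 'a::banach"
  assumes cont: "continuous_on {0<..} h"
    and bound: "\<And>t. t > 0 \<Longrightarrow> norm (h t) \<le> M * exp (w * t)"
    and zero: "\<And>l. l > l0 \<Longrightarrow> ((\<lambda>t. exp (- l * t) *\<^sub>R h t) has_integral 0) {0..}"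
    and t0: "t0 > 0"
  shows "h t0 = 0"
proof (rule ccontr)
  assume "h t0 \<noteq> 0"
  \<comment> \<open>The margin 1 serves twice: every \<open>l + real i\<close> exceeds
    \<open>l0\<close>, and \<open>k\<close> decays like \<open>exp (- t)\<close>, a majorant with
    integral 1.\<close>
  define l where "l = max l0 w + 1"
  define k where "k t = exp (- l * t) *\<^sub>R h t" for t
  have contk: "continuous_on {0<..} k"
    unfolding k_def by (intro continuous_intros cont)
  have boundk: "norm (k t) \<le> \<bar>M\<bar> * exp (- 1 * t)" if "t > 0" for t
  proof -
    have "norm (k t) \<le> exp (- l * t) * (M * exp (w * t))"
      unfolding k_def using bound[OF that] by simp
    also have "\<dots> = M * exp ((w - l) * t)" by (simp add: exp_add[symmetric] algebra_simps)
    also have "\<dots> \<le> \<bar>M\<bar> * exp (- 1 * t)"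
    proof (intro mult_mono)
      have "(w - l) * t \<le> - 1 * t" using that by (intro mult_right_mono) (auto simp: l_def)
      then show "exp ((w - l) * t) \<le> exp (- 1 * t)" by simp
    qed auto
    finally show ?thesis .
  qed
  have int_exp: "((\<lambda>t. exp (- 1 * t)) has_integral 1) {0::real..}"
    using has_integral_exp_minus_to_infinity[of 1 0] by simp
  have intk: "(\<lambda>t. \<phi> (exp (- t)) *\<^sub>R k t) integrable_on {0..}"
    if \<phi>: "continuous_on {0..1} \<phi>" for \<phi> :: "real \<Rightarrow> real"
  proof -
    have "bounded (\<phi> ` {0..1})"
      by (intro compact_imp_bounded compact_continuous_image \<phi> compact_Icc)
    then obtain B where "\<forall>y\<in>\<phi> ` {0..1}. norm y \<le> B" unfolding bounded_iff by blast
    then have B: "\<bar>\<phi> y\<bar> \<le> B" if "y \<in> {0..1}" for y using that by auto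
    show ?thesis
    proof (rule integrable_exp_decay[where d = 1 and M = "B * \<bar>M\<bar>"])
      show "continuous_on {0<..} (\<lambda>t. \<phi> (exp (- t)) *\<^sub>R k t)"
        by (intro continuous_intros contk continuous_on_compose2[OF \<phi>]) auto
      show "norm (\<phi> (exp (- t)) *\<^sub>R k t) \<le> B * \<bar>M\<bar> * exp (- 1 * t)" if "t > 0" for t
      proof -
        have le: "\<bar>\<phi> (exp (- t))\<bar> \<le> B" using that by (intro B) auto
        then have "B \<ge> 0" by linarith
        from mult_mono[OF le boundk[OF that] this] show ?thesis by (simp add: mult.assoc)
      qed
    qed simp
  qed
  have poly: "((\<lambda>t. p (exp (- t)) *\<^sub>R k t) has_integral 0) {0..}"
    if p0: "real_polynomial_function p" for p
  proof -
    obtain a n where p: "p = (\<lambda>y. \<Sum>i\<le>n. a i * y ^ i)"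
      using real_polynomial_function_imp_sum[OF p0] by blast
    have "((\<lambda>t. a i *\<^sub>R (exp (- (l + real i) * t) *\<^sub>R h t)) has_integral a i *\<^sub>R 0) {0..}" for i
      by (intro has_integral_cmul zero) (simp add: l_def)
    then have "((\<lambda>t. \<Sum>i\<le>n. a i *\<^sub>R (exp (- (l + real i) * t) *\<^sub>R h t))
        has_integral (\<Sum>i\<le>n. a i *\<^sub>R 0)) {0..}"
      by (intro has_integral_sum) auto
    moreover have "(\<Sum>i\<le>n. a i *\<^sub>R (exp (- (l + real i) * t) *\<^sub>R h t)) = p (exp (- t)) *\<^sub>R k t" for t
    proof -
      have "exp (- (l + real i) * t) = exp (- t) ^ i * exp (- l * t)" for i
        unfolding exp_of_nat_mult[symmetric] exp_add[symmetric] by (simp add: algebra_simps)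
      then show ?thesis by (simp add: p k_def scaleR_sum_left sum_distrib_right mult.assoc)
    qed
    ultimately show ?thesis by simp
  qed
  have moment: "integral {0..} (\<lambda>t. \<phi> (exp (- t)) *\<^sub>R k t) = 0"
    if \<phi>: "continuous_on {0..1} \<phi>" for \<phi> :: "real \<Rightarrow> real"
  proof -
    \<comment> \<open>A uniform error \<open>e\<close> on the unit interval costs at most
      \<open>e * \<bar>M\<bar>\<close>, since \<open>exp (- 1 * t)\<close> integrates to 1.\<close>
    have approx: "norm (integral {0..} (\<lambda>t. \<phi> (exp (- t)) *\<^sub>R k t)) \<le> 0 + e * \<bar>M\<bar>" if e: "e > 0" for e
    proof -
      obtain p where p: "real_polynomial_function p" "\<And>y. y \<in> {0..1} \<Longrightarrow> \<bar>\<phi> y - p y\<bar> < e"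
        using Stone_Weierstrass_real_polynomial_function[OF compact_Icc \<phi> e] by metis
      have "norm (integral {0..} (\<lambda>t. \<phi> (exp (- t)) *\<^sub>R k t - p (exp (- t)) *\<^sub>R k t))
          \<le> integral {0..} (\<lambda>t. e * \<bar>M\<bar> * exp (- 1 * t))"
      proof (rule integral_norm_bound_integral_spike_finite[where F = "{0}"])
        show "norm (\<phi> (exp (- t)) *\<^sub>R k t - p (exp (- t)) *\<^sub>R k t) \<le> e * \<bar>M\<bar> * exp (- 1 * t)"
          if "t \<in> {0..} - {0}" for t
          using mult_mono[OF less_imp_le[OF p(2)[of "exp (- t)"]] boundk[of t]] that e
          by (simp add: scaleR_diff_left[symmetric] mult.assoc)
      qed (use intk[OF \<phi>] has_integral_integrable[OF poly[OF p(1)]] has_integral_integrable[OF int_exp] in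
          \<open>auto intro!: integrable_diff integrable_on_mult_right\<close>)
      moreover have "integral {0..} (\<lambda>t. e * \<bar>M\<bar> * exp (- 1 * t)) = e * \<bar>M\<bar>"
        using integral_unique[OF has_integral_mult_right[OF int_exp]] by simp
      moreover have "integral {0..} (\<lambda>t. \<phi> (exp (- t)) *\<^sub>R k t - p (exp (- t)) *\<^sub>R k t)
          = integral {0..} (\<lambda>t. \<phi> (exp (- t)) *\<^sub>R k t)"
        using integral_diff[OF intk[OF \<phi>] has_integral_integrable[OF poly[OF p(1)]]]
          integral_unique[OF poly[OF p(1)]] by simp
      ultimately show ?thesis by (simp only: add_0)
    qed
    have "norm (integral {0..} (\<lambda>t. \<phi> (exp (- t)) *\<^sub>R k t)) \<le> 0"
    proof (rule field_le_epsilon)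
      fix e :: real assume "e > 0"
      have "e / (\<bar>M\<bar> + 1) * \<bar>M\<bar> \<le> e" using \<open>e > 0\<close> by (simp add: field_simps)
      moreover have "e / (\<bar>M\<bar> + 1) > 0" using \<open>e > 0\<close> by (simp add: add_nonneg_pos)
      ultimately show "norm (integral {0..} (\<lambda>t. \<phi> (exp (- t)) *\<^sub>R k t)) \<le> 0 + e"
        using approx by fastforce
    qed
    then show ?thesis by simp
  qed

  define v where "v = k t0"
  have v: "v \<noteq> 0" using \<open>h t0 \<noteq> 0\<close> by (simp add: v_def k_def)
  define y0 where "y0 = exp (- t0)"
  have y0: "y0 \<in> {0<..<1}" using t0 by (simp add: y0_def)
  have "continuous_on {0<..<1} (\<lambda>y. k (- ln y))"
    by (intro continuous_on_compose2[OF contk] continuous_intros) auto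
  then have "isCont (\<lambda>y. k (- ln y)) y0" using y0 by (simp add: continuous_on_eq_continuous_at)
  moreover have "norm v / 2 > 0" using v by simp
  ultimately obtain r0 where r0: "r0 > 0"
    "\<And>y. dist y y0 < r0 \<Longrightarrow> dist (k (- ln y)) (k (- ln y0)) < norm v / 2"
    unfolding continuous_at_eps_delta by blast
  \<comment> \<open>The bound \<open>y0 / 2\<close> keeps the support of the tent away from 0, that
    is, away from infinite time, where the tent must vanish to be integrable in
    \<open>t\<close>.\<close>
  define r where "r = min r0 (y0 / 2)"
  have r: "r > 0" "r \<le> r0" "r \<le> y0 / 2" using r0 y0 by (auto simp: r_def)
  have near: "norm (k t - v) \<le> norm v / 2" if "\<bar>exp (- t) - y0\<bar> < r" for t
    using r0(2)[of "exp (- t)"] that r by (simp add: dist_norm v_def y0_def)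
  define \<phi> where "\<phi> y = max 0 (r - \<bar>y - y0\<bar>)" for y
  have \<phi>: "continuous_on {0..1} \<phi>" unfolding \<phi>_def by (intro continuous_intros)
  \<comment> \<open>On the support \<open>exp (- t)\<close> exceeds \<open>y0 / 2\<close>, so the
    height \<open>r\<close> is at most \<open>2 * r / y0\<close> times
    \<open>exp (- t)\<close>.\<close>
  have \<phi>_bound: "\<phi> (exp (- t)) \<le> 2 * r / y0 * exp (- 1 * t)" for t
  proof (cases "exp (- t) > y0 / 2")
    case True
    have "\<phi> (exp (- t)) \<le> r" using r by (simp add: \<phi>_def)
    also have "\<dots> \<le> 2 * r / y0 * exp (- 1 * t)"
      using True r y0 by (simp add: field_simps)
    finally show ?thesis .
  next
    case False
    then have "\<phi> (exp (- t)) = 0" using r by (simp add: \<phi>_def)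
    then show ?thesis using r y0 by simp
  qed
  have int\<phi>: "(\<lambda>t. \<phi> (exp (- t))) integrable_on {0..}"
  proof (rule integrable_exp_decay[where d = 1 and M = "2 * r / y0"])
    show "continuous_on {0<..} (\<lambda>t. \<phi> (exp (- t)))" unfolding \<phi>_def by (intro continuous_intros)
    show "norm (\<phi> (exp (- t))) \<le> 2 * r / y0 * exp (- 1 * t)" for t
      using \<phi>_bound[of t] by (simp add: \<phi>_def)
  qed simp
  define c where "c = integral {0..} (\<lambda>t. \<phi> (exp (- t)))"
  have "c > 0"
  proof -
    have "isCont (\<lambda>t. exp (- t)) t0" by (intro continuous_intros)
    moreover have "r / 2 > 0" using r by simp
    ultimately obtain s where s: "s > 0" "\<And>t. dist t t0 < s \<Longrightarrow> dist (exp (- t)) (exp (- t0)) < r / 2"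
      unfolding continuous_at_eps_delta by blast
    have "integral {t0..t0 + s / 2} (\<lambda>_. r / 2) \<le> integral {t0..t0 + s / 2} (\<lambda>t. \<phi> (exp (- t)))"
    proof (rule integral_le)
      show "(\<lambda>t. \<phi> (exp (- t))) integrable_on {t0..t0 + s / 2}"
        unfolding \<phi>_def by (intro integrable_continuous_interval continuous_intros)
      show "r / 2 \<le> \<phi> (exp (- t))" if "t \<in> {t0..t0 + s / 2}" for t
      proof -
        have "\<bar>exp (- t) - y0\<bar> < r / 2"
          using s(2)[of t] s(1) that by (simp add: y0_def dist_real_def)
        then show ?thesis by (simp add: \<phi>_def le_max_iff_disj)
      qed
    qed auto
    also have "\<dots> \<le> c" unfolding c_def
    proof (rule integral_subset_le)
      show "(\<lambda>t. \<phi> (exp (- t))) integrable_on {t0..t0 + s / 2}"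
        unfolding \<phi>_def by (intro integrable_continuous_interval continuous_intros)
    qed (use t0 int\<phi> in \<open>auto simp: \<phi>_def\<close>)
    finally have "s / 2 * (r / 2) \<le> c" using s(1) by simp
    moreover have "s / 2 * (r / 2) > 0" using s(1) r(1) by simp
    ultimately show ?thesis by linarith
  qed
  \<comment> \<open>The integral against \<open>k\<close> is 0 and the one against the constant
    \<open>v\<close> is \<open>c *\<^sub>R v\<close>. Since \<open>k\<close> is within
    \<open>norm v / 2\<close> of \<open>v\<close> on the support, \<open>c * norm v\<close> would be
    at most half of itself.\<close>
  have "norm (integral {0..} (\<lambda>t. \<phi> (exp (- t)) *\<^sub>R k t - \<phi> (exp (- t)) *\<^sub>R v))
      \<le> integral {0..} (\<lambda>t. \<phi> (exp (- t)) * (norm v / 2))"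
  proof (rule integral_norm_bound_integral)
    show "norm (\<phi> (exp (- t)) *\<^sub>R k t - \<phi> (exp (- t)) *\<^sub>R v) \<le> \<phi> (exp (- t)) * (norm v / 2)" for t
    proof (cases "\<bar>exp (- t) - y0\<bar> < r")
      case True
      then show ?thesis
        using mult_left_mono[OF near[OF True], of "\<phi> (exp (- t))"]
        by (simp add: scaleR_diff_right[symmetric] \<phi>_def)
    qed (simp add: \<phi>_def)
  qed (use int\<phi> intk[OF \<phi>] in \<open>auto intro!: integrable_diff integrable_on_mult_left integrable_on_scaleR_left\<close>)
  also have "integral {0..} (\<lambda>t. \<phi> (exp (- t)) *\<^sub>R k t - \<phi> (exp (- t)) *\<^sub>R v) = - (c *\<^sub>R v)"
    using integral_diff[OF intk[OF \<phi>] integrable_on_scaleR_left[OF int\<phi>, of v]] moment[OF \<phi>]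
    unfolding c_def by (simp add: integral_unique[OF has_integral_scaleR_left[OF integrable_integral[OF int\<phi>]]])
  also have "integral {0..} (\<lambda>t. \<phi> (exp (- t)) * (norm v / 2)) = c * (norm v / 2)"
    unfolding c_def by (rule integral_mult_left)
  finally show False using \<open>c > 0\<close> v by simp
qed

section \<open>The convolution theorem for kernels with a discontinuity on the axes\<close>

lemma
  fixes c d :: real
  assumes "c \<le> d"
  shows integrable_on_indicator_Icc: "(\<lambda>s. if s \<in> {c..d} then 1 else 0 :: real) integrable_on {a..b}" (is ?A)
    and integral_indicator_Icc_le: "integral {a..b} (\<lambda>s. if s \<in> {c..d} then 1 else 0 :: real) \<le> d - c" (is ?B)
proof -
  have eq: "{c..d} \<inter> {a..b} = {max c a..min d b}" by auto
  show ?A by (subst integrable_restrict_Int) (simp add: eq integrable_const_ivl)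
  show ?B by (subst integral_restrict_Int) (use assms in \<open>auto simp: eq\<close>)
qed

text \<open>The function vanishes up to \<open>e\<close>, not merely up to 0, so that the cut kernel
  is zero on an open set containing both axes, whatever the kernel does there.\<close>

definition cutoff :: "real \<Rightarrow> real \<Rightarrow> real" where
  "cutoff e r = min 1 (max 0 (r / e - 1))"

lemma cutoff_nonneg: "0 \<le> cutoff e r" and cutoff_le_1: "cutoff e r \<le> 1"
  by (auto simp: cutoff_def)

lemma cutoff_eq_0: "e > 0 \<Longrightarrow> r \<le> e \<Longrightarrow> cutoff e r = 0"
  by (simp add: cutoff_def field_simps)

lemma cutoff_eq_1: "e > 0 \<Longrightarrow> r \<ge> 2 * e \<Longrightarrow> cutoff e r = 1"
  by (simp add: cutoff_def field_simps)

lemma continuous_on_cutoff [continuous_intros]: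
  "continuous_on S f \<Longrightarrow> continuous_on S (\<lambda>x. cutoff e (f x))"
  unfolding cutoff_def divide_inverse by (intro continuous_intros)

lemma one_minus_cutoff_le: "e > 0 \<Longrightarrow> r \<ge> 0 \<Longrightarrow> 1 - cutoff e r \<le> (if r \<in> {0..2 * e} then 1 else 0)"
  using cutoff_eq_1[of e r] cutoff_nonneg[of e r] by auto

text \<open>
  The integrand of the convolution need not have a limit at the end points. Multiplying the kernel by
  cutoffs in both variables makes it jointly continuous on the whole plane, so that the library's
  Fubini theorem for continuous functions applies; the error is uniformly small because the kernel
  is bounded.
\<close>

locale decaying_kernel =
  fixes G :: "real \<Rightarrow> real \<Rightarrow> 'a::banach" and M d :: real
  assumes cont: "continuous_on ({0<..} \<times> {0<..}) (\<lambda>(r, s). G r s)"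
    and bound: "\<And>r s. r > 0 \<Longrightarrow> s > 0 \<Longrightarrow> norm (G r s) \<le> M * exp (- d * (r + s))"
    and d: "d > 0"
begin

lemma M_nonneg: "M \<ge> 0"
  using order_trans[OF norm_ge_zero bound[of 1 1]] by (simp add: zero_le_mult_iff)

lemma bound_M: "r > 0 \<Longrightarrow> s > 0 \<Longrightarrow> norm (G r s) \<le> M"
proof -
  assume "r > 0" "s > 0"
  then have "M * exp (- d * (r + s)) \<le> M * 1"
    using M_nonneg d by (intro mult_left_mono) auto
  then show ?thesis using bound[OF \<open>r > 0\<close> \<open>s > 0\<close>] by simp
qed

definition cut :: "real \<Rightarrow> real \<Rightarrow> real \<Rightarrow> 'a" where
  "cut e r s = (cutoff e r * cutoff e s) *\<^sub>R G r s"

text \<open>Two open sets are glued: the open quadrant, where \<open>G\<close> is continuous, and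
  the points with a coordinate below \<open>e\<close>, where the cutoffs give 0.\<close>

lemma continuous_on_cut:
  assumes "e > 0"
  shows "continuous_on UNIV (\<lambda>(r, s). cut e r s)"
proof -
  have "continuous_on ({0<..} \<times> {0<..}) (\<lambda>z. (cutoff e (fst z) * cutoff e (snd z)) *\<^sub>R (case z of (r, s) \<Rightarrow> G r s))"
    by (intro continuous_intros cont)
  then have 1: "continuous_on ({0<..} \<times> {0<..}) (\<lambda>(r, s). cut e r s)"
    by (simp add: cut_def case_prod_unfold)
  have "(\<lambda>(r, s). cut e r s) z = 0" if "z \<in> {..<e} \<times> UNIV \<union> UNIV \<times> {..<e}" for z
    using that assms by (auto simp: cut_def cutoff_eq_0)
  then have 2: "continuous_on ({..<e} \<times> UNIV \<union> UNIV \<times> {..<e}) (\<lambda>(r, s). cut e r s)"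
    using continuous_on_cong[OF refl, of "{..<e} \<times> UNIV \<union> UNIV \<times> {..<e}" "\<lambda>(r, s). cut e r s" "\<lambda>_. 0"] by auto
  have "{0<..} \<times> {0<..} \<union> ({..<e} \<times> UNIV \<union> UNIV \<times> {..<e}) = (UNIV :: (real \<times> real) set)"
    using assms by auto
  then show ?thesis
    using continuous_on_open_Un[OF _ _ 1 2] by (simp add: open_Times open_Un)
qed

lemma continuous_on_cut_compose [continuous_intros]:
  assumes "e > 0" "continuous_on S f" "continuous_on S g"
  shows "continuous_on S (\<lambda>x. cut e (f x) (g x))"
  using continuous_on_compose2[OF continuous_on_cut[OF assms(1)] continuous_on_Pair[OF assms(2,3)]]
  by simp

lemma cut_eq_0: "e > 0 \<Longrightarrow> r \<le> e \<or> s \<le> e \<Longrightarrow> cut e r s = 0"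
  by (auto simp: cut_def cutoff_eq_0)

text \<open>The error sits in two strips along the axes: \<open>0 \<le> (1 - a) * (1 - b)\<close>
  means \<open>1 - a * b \<le> (1 - a) + (1 - b)\<close>. The factor \<open>norm (G r s)\<close> is
  kept so that either the uniform or the exponential bound can be inserted for each strip.\<close>

lemma norm_diff_cut:
  assumes "e > 0" "r > 0" "s > 0"
  shows "norm (G r s - cut e r s) \<le>
    norm (G r s) * ((if r \<in> {0..2 * e} then 1 else 0) + (if s \<in> {0..2 * e} then 1 else 0))"
proof -
  let ?a = "cutoff e r" and ?b = "cutoff e s"
  have eq: "G r s - cut e r s = (1 - ?a * ?b) *\<^sub>R G r s" by (simp add: cut_def algebra_simps)
  have "\<bar>1 - ?a * ?b\<bar> \<le> (1 - ?a) + (1 - ?b)"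
  proof -
    have "?a * ?b \<le> 1" by (simp add: mult_le_one cutoff_nonneg cutoff_le_1)
    moreover have "0 \<le> (1 - ?a) * (1 - ?b)" by (simp add: cutoff_le_1)
    ultimately show ?thesis by (simp add: algebra_simps)
  qed
  also have "\<dots> \<le> (if r \<in> {0..2 * e} then 1 else 0) + (if s \<in> {0..2 * e} then 1 else 0)"
    using assms by (intro add_mono one_minus_cutoff_le) auto
  finally show ?thesis
    unfolding eq norm_scaleR by (subst mult.commute) (rule mult_left_mono, simp_all)
qed

definition convolution :: "real \<Rightarrow> 'a" where
  "convolution t = integral {0..t} (\<lambda>s. G (t - s) s)"

text \<open>The upper limit is a fixed \<open>R\<close> instead of \<open>t\<close>. The cut kernel
  vanishes for \<open>s \<ge> t\<close>, so nothing changes for \<open>t \<in> {0..R}\<close>, and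
  the result is a parameter integral over a square.\<close>

definition cut_convolution :: "real \<Rightarrow> real \<Rightarrow> real \<Rightarrow> 'a" where
  "cut_convolution e R t = integral {0..R} (\<lambda>s. cut e (t - s) s)"

lemma integrable_convolution: "(\<lambda>s. G (t - s) s) integrable_on {0..t}"
proof (rule integrable_bounded_continuous_Ioo[where B = M])
  show "continuous_on {0<..<t} (\<lambda>s. G (t - s) s)"
  proof -
    have "continuous_on {0<..<t} (\<lambda>s. (t - s, s))" by (intro continuous_intros)
    moreover have "(\<lambda>s. (t - s, s)) ` {0<..<t} \<subseteq> {0<..} \<times> {0<..}" by auto
    ultimately show ?thesis using continuous_on_compose2[OF cont] by fastforce
  qed
qed (auto intro: bound_M)

text \<open>Along the line of convolution the exponent depends only on \<open>r + s = t\<close>, so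
  the majorant is constant.\<close>

lemma norm_convolution: 
  assumes "t \<ge> 0"
  shows "norm (convolution t) \<le> M * t * exp (- d * t)"
proof -
  have "norm (convolution t) \<le> integral {0..t} (\<lambda>s. M * exp (- d * t))"
    unfolding convolution_def using bound[of "t - s" s for s]
    by (intro integral_norm_bound_integral_spike_finite[where F = "{0, t}"] integrable_convolution) auto
  then show ?thesis using assms by (simp add: mult_ac)
qed

lemma continuous_on_cut_convolution:
  assumes "e > 0"
  shows "continuous_on {0..R} (cut_convolution e R)"
proof -
  have "continuous_on ({0..R} \<times> cbox 0 R) (\<lambda>(t, s). cut e (t - s) s)"
    using assms by (auto intro!: continuous_intros simp: case_prod_unfold)
  from integral_continuous_on_param[OF this] show ?thesis by (simp add: cut_convolution_def[abs_def])
qed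

lemma norm_convolution_diff_cut:
  assumes e: "e > 0" and t: "t \<in> {0..R}"
  shows "norm (convolution t - cut_convolution e R t) \<le> M * (4 * e)"
proof -
  \<comment> \<open>Cutting the first variable matters for \<open>s\<close> within
    \<open>2 * e\<close> of \<open>t\<close>, cutting the second for \<open>s\<close> within
    \<open>2 * e\<close> of 0. Together these have length at most \<open>4 * e\<close>, uniformly in
    \<open>t\<close>.\<close>
  let ?K = "\<lambda>s. M * ((if s \<in> {t - 2 * e..t} then 1 else 0) + (if s \<in> {0..2 * e} then 1 else 0))"
  have int: "(\<lambda>s. cut e (t - s) s) integrable_on {a..b}" for a b
    using e by (intro integrable_continuous_interval continuous_intros)
  have ind: "(\<lambda>s. if s \<in> {t - 2 * e..t} then 1 else 0 :: real) integrable_on {0..t}"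
    "(\<lambda>s. if s \<in> {0..2 * e} then 1 else 0 :: real) integrable_on {0..t}"
    using e by (intro integrable_on_indicator_Icc; simp)+
  have "integral {t..R} (\<lambda>s. cut e (t - s) s) = integral {t..R} (\<lambda>s. 0)"
    using e by (intro integral_cong) (auto intro: cut_eq_0)
  then have cut_convolution: "cut_convolution e R t = integral {0..t} (\<lambda>s. cut e (t - s) s)"
    using Henstock_Kurzweil_Integration.integral_combine[OF _ _ int[of 0 R], of t] t by (simp add: cut_convolution_def)
  have "norm (convolution t - cut_convolution e R t) = norm (integral {0..t} (\<lambda>s. G (t - s) s - cut e (t - s) s))"
    unfolding convolution_def cut_convolution by (subst integral_diff) (auto intro: integrable_convolution int)
  also have "\<dots> \<le> integral {0..t} ?K"
  proof (rule integral_norm_bound_integral_spike_finite[where F = "{0, t}"])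
    show "norm (G (t - s) s - cut e (t - s) s) \<le> ?K s" if "s \<in> {0..t} - {0, t}" for s
      by (rule order_trans[OF norm_diff_cut mult_mono]) (use that e bound_M[of "t - s" s] M_nonneg in auto)
  qed (use ind in \<open>auto intro!: integrable_diff integrable_convolution int integrable_on_mult_right integrable_add\<close>)
  also have "\<dots> \<le> M * (4 * e)"
    using integral_indicator_Icc_le[of "t - 2 * e" t 0 t] integral_indicator_Icc_le[of 0 "2 * e" 0 t] e
    by (subst integral_mult_right, subst integral_add[OF ind]) (auto intro!: mult_left_mono M_nonneg)
  finally show ?thesis .
qed

text \<open>On each \<open>{0..R}\<close> the continuous cut convolutions converge uniformly, with
  error at most \<open>M * (4 * e)\<close>.\<close>

lemma continuous_on_convolution: "continuous_on {0<..} convolution"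
proof -
  have "continuous_on {0..R} convolution" for R
  proof (rule uniform_limit_theorem)
    show "\<forall>\<^sub>F n in sequentially. continuous_on {0..R} (cut_convolution (1 / Suc n) R)"
      by (intro always_eventually allI continuous_on_cut_convolution) auto
    show "uniform_limit {0..R} (\<lambda>n. cut_convolution (1 / Suc n) R) convolution sequentially"
    proof (rule uniform_limitI)
      fix e :: real assume "e > 0"
      have "(\<lambda>n. M * (4 * (1 / Suc n))) \<longlonglongrightarrow> M * (4 * 0)"
        by (intro tendsto_intros LIMSEQ_Suc[OF lim_inverse_n'])
      then have "\<forall>\<^sub>F n in sequentially. M * (4 * (1 / Suc n)) < e"
        using \<open>e > 0\<close> by (auto dest: order_tendstoD)
      then show "\<forall>\<^sub>F n in sequentially. \<forall>t\<in>{0..R}. dist (cut_convolution (1 / Suc n) R t) (convolution t) < e"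
      proof eventually_elim
        case (elim n)
        then show ?case
          using norm_convolution_diff_cut[of "1 / Suc n" _ R] by (force simp: dist_norm norm_minus_commute)
      qed
    qed
  qed simp
  then have "isCont convolution t" if "t > 0" for t
    using that continuous_on_interior[of "{0..t + 1}" convolution t] by auto
  then show ?thesis by (auto intro: continuous_at_imp_continuous_on)
qed

lemma integrable_convolution_Ici: "convolution integrable_on {0..}"
proof (rule integrable_exp_decay[OF continuous_on_convolution, where d = "d / 2" and M = "2 * M / d"])
  fix t :: real assume t: "t > 0"
  \<comment> \<open>Half of the decay rate is spent on absorbing the factor
    \<open>t\<close>.\<close>
  have "d * t / 2 \<le> exp (d * t / 2)" using exp_ge_add_one_self[of "d * t / 2"] by linarith
  then have "t \<le> 2 / d * exp (d * t / 2)" using d by (simp add: field_simps)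
  then have "M * t * exp (- d * t) \<le> M * (2 / d * exp (d * t / 2)) * exp (- d * t)"
    by (intro mult_right_mono mult_left_mono M_nonneg) auto
  also have "\<dots> = 2 * M / d * (exp (d * t / 2) * exp (- d * t))" by simp
  also have "exp (d * t / 2) * exp (- d * t) = exp (- (d / 2) * t)"
    by (simp add: exp_add[symmetric])
  finally show "norm (convolution t) \<le> 2 * M / d * exp (- (d / 2) * t)" using norm_convolution[of t] t by simp
qed (use d in simp)

text \<open>The substitution \<open>r = t - s\<close> compares the full section integral with its
  part inside the square. The three errors come from the strip near \<open>r = 0\<close>, from
  \<open>s\<close> lying in the strip near 0, and from the tail \<open>r > R - s\<close>. The second
  is not small for such \<open>s\<close>, but becomes small once integrated over
  \<open>s\<close>.\<close>

lemma norm_section_diff: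
  assumes e: "e > 0" and s: "0 < s" "s \<le> R"
    and g: "((\<lambda>r. G r s) has_integral g) {0..}"
  shows "norm (g - integral {0..R} (\<lambda>t. cut e (t - s) s)) \<le>
    M * (2 * e + (if s \<in> {0..2 * e} then 1 else 0) / d + 2 / d * exp (- d * R / 2))"
proof -
  let ?ind = "\<lambda>r. if r \<in> {0..2 * e} then 1 else 0 :: real"
  let ?C = "\<lambda>r. if r \<in> {- s..R - s} then cut e r s else 0"
  let ?K = "\<lambda>r. M * (?ind r + ?ind s * exp (- d * r) + exp (- d * R / 2) * exp (- (d / 2) * r))"
  have intcut: "(\<lambda>r. cut e r s) integrable_on {a..b}" for a b
    using e by (intro integrable_continuous_interval continuous_intros)
  have "integral {0..R} (\<lambda>t. cut e (t - s) s) = integral {- s..R - s} (\<lambda>r. cut e r s)"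
  proof (rule integral_unique)
    have "((\<lambda>r. cut e r s) has_integral integral {- s..R - s} (\<lambda>r. cut e r s)) {- s..R - s}"
      by (intro integrable_integral intcut)
    moreover have "(\<lambda>t. cut e (t - s) s) \<circ> (+) s = (\<lambda>r. cut e r s)" by (simp add: o_def)
    ultimately show "((\<lambda>t. cut e (t - s) s) has_integral integral {- s..R - s} (\<lambda>r. cut e r s)) {0..R}"
      using has_integral_shift_Icc_real[of "\<lambda>t. cut e (t - s) s" s _ "- s" "R - s"] by simp
  qed
  also have "\<dots> = integral {0..R - s} (\<lambda>r. cut e r s)"
  proof -
    have "integral {- s..0} (\<lambda>r. cut e r s) = integral {- s..0} (\<lambda>r. 0)"
      using e by (intro integral_cong) (auto intro: cut_eq_0)
    then show ?thesis
      using Henstock_Kurzweil_Integration.integral_combine[OF _ _ intcut[of "- s" "R - s"], of 0] s by simp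
  qed
  also have "\<dots> = integral {0..} ?C"
  proof -
    have "{- s..R - s} \<inter> {0..} = {0..R - s}" using s by auto
    then show ?thesis by (simp only: integral_restrict_Int)
  qed
  finally have eq: "integral {0..R} (\<lambda>t. cut e (t - s) s) = integral {0..} ?C" .
  have intC: "?C integrable_on {0..}"
  proof -
    have "{- s..R - s} \<inter> {0..} = {0..R - s}" using s by auto
    then show ?thesis by (simp only: integrable_restrict_Int intcut)
  qed
  have ind: "(?ind has_integral 2 * e) {0..}"
  proof -
    have "{0..2 * e} \<inter> {0..} = {0..2 * e}" by auto
    then show ?thesis
      using has_integral_const_real[of "1::real" 0 "2 * e"] e by (subst has_integral_restrict_Int) simp
  qed
  have e1: "((\<lambda>r. exp (- d * r)) has_integral 1 / d) {0..}"
    using has_integral_exp_minus_to_infinity[OF d, of 0] by simp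
  have e2: "((\<lambda>r. exp (- (d / 2) * r)) has_integral 2 / d) {0..}"
    using has_integral_exp_minus_to_infinity[of "d / 2" 0] d by simp
  have K: "(?K has_integral M * (2 * e + ?ind s * (1 / d) + exp (- d * R / 2) * (2 / d))) {0..}"
    by (intro has_integral_mult_right has_integral_add ind e1 e2)
  have "norm (integral {0..} (\<lambda>r. G r s - ?C r)) \<le> integral {0..} ?K"
  proof (rule integral_norm_bound_integral_spike_finite[where F = "{0}"])
    show "norm (G r s - ?C r) \<le> ?K r" if "r \<in> {0..} - {0}" for r
    proof -
      have r: "r > 0" using that by auto
      have G1: "norm (G r s) \<le> M * exp (- d * r)"
      proof (rule order_trans[OF bound[OF r s(1)]])
        show "M * exp (- d * (r + s)) \<le> M * exp (- d * r)"
          using d s by (intro mult_left_mono M_nonneg) (simp add: algebra_simps)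
      qed
      show ?thesis
      proof (cases "r \<le> R - s")
        case True
        then have "norm (G r s - ?C r) \<le> norm (G r s) * (?ind r + ?ind s)"
          using norm_diff_cut[OF e r s(1)] s r by simp
        also have "\<dots> \<le> M * ?ind r + M * exp (- d * r) * ?ind s"
          unfolding distrib_left
          by (intro add_mono mult_right_mono bound_M G1 r s) auto
        also have "\<dots> \<le> ?K r" using M_nonneg by (simp add: algebra_simps)
        finally show ?thesis .
      next
        case False
        have "norm (G r s) \<le> M * exp (- d * (r + s))" by (rule bound[OF r s(1)])
        also have "\<dots> \<le> M * (exp (- d * R / 2) * exp (- (d / 2) * r))"
        proof (intro mult_left_mono M_nonneg)
          \<comment> \<open>In the tail both \<open>r + s > R\<close> and \<open>r + s > r\<close>
            hold. Averaging them splits the decay into a factor in \<open>R\<close> and one that is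
            still integrable in \<open>r\<close>.\<close>
          have "d * (R + r) \<le> d * (2 * (r + s))" using False d s by (intro mult_left_mono) auto
          then show "exp (- d * (r + s)) \<le> exp (- d * R / 2) * exp (- (d / 2) * r)"
            by (simp add: exp_add[symmetric] field_simps)
        qed
        also have "\<dots> \<le> ?K r" using M_nonneg by (intro mult_left_mono) auto
        finally show ?thesis using False by simp
      qed
    qed
  qed (use g K intC in \<open>auto intro!: integrable_diff\<close>)
  also have "integral {0..} (\<lambda>r. G r s - ?C r) = g - integral {0..R} (\<lambda>t. cut e (t - s) s)"
    unfolding eq using integral_diff[OF has_integral_integrable[OF g] intC] integral_unique[OF g] by simp
  also have "integral {0..} ?K = M * (2 * e + ?ind s * (1 / d) + exp (- d * R / 2) * (2 / d))"
    by (rule integral_unique[OF K])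
  also have "\<dots> = M * (2 * e + ?ind s / d + 2 / d * exp (- d * R / 2))" by simp
  finally show ?thesis .
qed

text \<open>The order of integration is exchanged for the cut kernel on the square of side
  \<open>R\<close>. With \<open>R\<close> fixed, the width \<open>e\<close> tends to 0 first; this
  leaves a constant times \<open>R * exp (- d * R / 2)\<close>, which vanishes as \<open>R\<close>
  grows.\<close>

theorem has_integral_convolution:
  assumes g: "\<And>s. s > 0 \<Longrightarrow> ((\<lambda>r. G r s) has_integral g s) {0..}"
    and I: "(g has_integral I) {0..}"
  shows "(convolution has_integral I) {0..}"
proof -
  have "norm (integral {0..R} convolution - integral {0..R} g) \<le> M * (2 / d) * (R * exp (- d * R / 2))"
    if R: "R > 0" for R
  proof -
    have int_conv: "convolution integrable_on {0..R}"
      by (rule integrable_on_subinterval[OF integrable_convolution_Ici]) simp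
    have int_g: "g integrable_on {0..R}"
      by (rule integrable_on_subinterval[OF has_integral_integrable[OF I]]) simp
    \<comment> \<open>In the last factor \<open>4 * R\<close> is the cost of cutting the convolution
      and \<open>2 * R + 2 / d\<close> that of cutting the sections.\<close>
    have main: "norm (integral {0..R} convolution - integral {0..R} g) \<le>
        M * (2 / d) * (R * exp (- d * R / 2)) + e * (M * (6 * R + 2 / d))" if e: "e > 0" for e
    proof -
      let ?ind = "\<lambda>s. if s \<in> {0..2 * e} then 1 else 0 :: real"
      let ?in = "\<lambda>s. integral {0..R} (\<lambda>t. cut e (t - s) s)"
      have int_cut: "cut_convolution e R integrable_on {0..R}"
        by (intro integrable_continuous_interval continuous_on_cut_convolution e)
      have "continuous_on ({0..R} \<times> cbox 0 R) (\<lambda>(s, t). cut e (t - s) s)"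
        using e by (auto intro!: continuous_intros simp: case_prod_unfold)
      from integral_continuous_on_param[OF this] have int_in: "?in integrable_on {0..R}"
        by (intro integrable_continuous_interval) simp
      have swap: "integral {0..R} (cut_convolution e R) = integral {0..R} ?in"
      proof -
        have "continuous_on (cbox (0, 0) (R, R)) (\<lambda>(t, s). cut e (t - s) s)"
          using e by (auto intro!: continuous_intros simp: case_prod_unfold)
        from integral_swap_continuous[OF this] show ?thesis by (simp add: cut_convolution_def[abs_def])
      qed
      have "norm (integral {0..R} convolution - integral {0..R} (cut_convolution e R)) \<le> integral {0..R} (\<lambda>_. M * (4 * e))"
        using norm_convolution_diff_cut[OF e]
        by (subst integral_diff[OF int_conv int_cut, symmetric], intro integral_norm_bound_integral)
          (auto intro!: integrable_diff int_conv int_cut)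
      then have 1: "norm (integral {0..R} convolution - integral {0..R} ?in) \<le> R * (M * (4 * e))"
        unfolding swap using R by (simp add: mult_ac)
      let ?B = "\<lambda>s. M * (2 * e + ?ind s / d + 2 / d * exp (- d * R / 2))"
      have ind: "?ind integrable_on {0..R}" using e by (intro integrable_on_indicator_Icc) simp
      have "norm (integral {0..R} g - integral {0..R} ?in) \<le> integral {0..R} ?B"
      proof (subst integral_diff[OF int_g int_in, symmetric],
          rule integral_norm_bound_integral_spike_finite[where F = "{0}"])
        show "norm (g s - ?in s) \<le> ?B s" if "s \<in> {0..R} - {0}" for s
          using that by (intro norm_section_diff e g) auto
        show "?B integrable_on {0..R}" using ind
          by (intro integrable_on_mult_right integrable_add integrable_const_ivl)
            (auto simp: divide_inverse intro!: integrable_on_mult_left)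
      qed (auto intro: integrable_diff int_g int_in)
      also have "integral {0..R} ?B = M * (R * (2 * e) + integral {0..R} ?ind / d + R * (2 / d * exp (- d * R / 2)))"
      proof -
        have "((\<lambda>s. ?ind s * (1 / d)) has_integral integral {0..R} ?ind * (1 / d)) {0..R}"
          by (intro has_integral_mult_left integrable_integral ind)
        then have "(?B has_integral M * (R * (2 * e) + integral {0..R} ?ind / d + R * (2 / d * exp (- d * R / 2)))) {0..R}"
          using has_integral_const_real[of "2 * e" 0 R]
            has_integral_const_real[of "2 / d * exp (- d * R / 2)" 0 R] R
          by (intro has_integral_mult_right has_integral_add) auto
        then show ?thesis by (rule integral_unique)
      qed
      also have "\<dots> \<le> M * (R * (2 * e) + 2 * e / d + R * (2 / d * exp (- d * R / 2)))"
        using integral_indicator_Icc_le[of 0 "2 * e" 0 R] e d R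
        by (intro mult_left_mono M_nonneg add_mono divide_right_mono) auto
      finally have 2: "norm (integral {0..R} g - integral {0..R} ?in) \<le>
        M * (R * (2 * e) + 2 * e / d + R * (2 / d * exp (- d * R / 2)))" .
      have "norm (integral {0..R} convolution - integral {0..R} g) \<le>
        R * (M * (4 * e)) + M * (R * (2 * e) + 2 * e / d + R * (2 / d * exp (- d * R / 2)))"
        using norm_triangle_ineq4[of "integral {0..R} convolution - integral {0..R} ?in" "integral {0..R} g - integral {0..R} ?in"] 1 2
        by simp
      also have "\<dots> = M * (2 / d) * (R * exp (- d * R / 2)) + e * (M * (6 * R + 2 / d))"
        by (simp add: algebra_simps)
      finally show ?thesis .
    qed
    show ?thesis
    proof (rule field_le_epsilon)
      fix \<epsilon> :: real assume \<epsilon>: "\<epsilon> > 0"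
      define K where "K = M * (6 * R + 2 / d)"
      have K: "K \<ge> 0" using R d M_nonneg by (simp add: K_def)
      then have "\<epsilon> / (K + 1) * K \<le> \<epsilon>" using \<epsilon> by (simp add: field_simps)
      then show "norm (integral {0..R} convolution - integral {0..R} g) \<le> M * (2 / d) * (R * exp (- d * R / 2)) + \<epsilon>"
        using main[of "\<epsilon> / (K + 1)"] \<epsilon> K unfolding K_def[symmetric] by auto
    qed
  qed
  then have ev: "\<forall>\<^sub>F R in at_top. norm (integral {0..R} convolution - integral {0..R} g) \<le> M * (2 / d) * (R * exp (- d * R / 2))"
    using eventually_gt_at_top[of 0] by (rule eventually_mono[rotated])
  have "((\<lambda>R. M * (2 / d) * (R * exp (- d * R / 2))) \<longlongrightarrow> M * (2 / d) * 0) at_top"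
  proof (intro tendsto_intros)
    have "filterlim (\<lambda>R. d / 2 * R) at_top at_top"
      using d by (intro filterlim_tendsto_pos_mult_at_top[OF tendsto_const] filterlim_ident) auto
    from filterlim_compose[OF tendsto_power_div_exp_0[of 1] this]
    have "((\<lambda>R. 2 / d * ((d / 2 * R) ^ 1 / exp (d / 2 * R))) \<longlongrightarrow> 2 / d * 0) at_top"
      by (rule tendsto_mult[OF tendsto_const])
    then show "((\<lambda>R. R * exp (- d * R / 2)) \<longlongrightarrow> 0) at_top"
      using d by (simp add: exp_minus field_simps)
  qed
  then have "((\<lambda>R. integral {0..R} convolution - integral {0..R} g) \<longlongrightarrow> 0) at_top"
    using ev by (intro Lim_null_comparison[OF ev]) auto
  moreover have "((\<lambda>R. integral {0..R} convolution - integral {0..R} g) \<longlongrightarrow> integral {0..} convolution - I) at_top"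
    by (intro tendsto_diff tendsto_integral_Icc_at_top I integrable_integral integrable_convolution_Ici)
  ultimately have "integral {0..} convolution - I = 0"
    using tendsto_unique[OF trivial_limit_at_top_linorder] by blast
  then show ?thesis using integrable_integral[OF integrable_convolution_Ici] by simp
qed

end

text \<open>A kernel in two variables, rather than a product, covers both \<open>S s x\<close> and
  \<open>S r (S s x)\<close>. The weight \<open>exp (- l * (r + s))\<close> makes it decay at rate
  \<open>l - w\<close> and, because \<open>r + s = t\<close>, factors out of the convolution.
  Continuity and growth do not involve \<open>l\<close> and are read off at
  \<open>l = w + 1\<close>.\<close>

lemma
  fixes H :: "real \<Rightarrow> real \<Rightarrow> 'a::banach"
  assumes cont: "continuous_on ({0<..} \<times> {0<..}) (\<lambda>(r, s). H r s)"
    and bound: "\<And>r s. r > 0 \<Longrightarrow> s > 0 \<Longrightarrow> norm (H r s) \<le> M * exp (w * (r + s))"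
  shows continuous_on_convolution: "continuous_on {0<..} (\<lambda>t. integral {0..t} (\<lambda>s. H (t - s) s))" (is ?A)
    and norm_convolution_le:
      "t > 0 \<Longrightarrow> norm (integral {0..t} (\<lambda>s. H (t - s) s)) \<le> M * t * exp (w * t)" (is "_ \<Longrightarrow> ?B")
    and laplace_convolution:
      "\<lbrakk>l > w; \<And>s. s > 0 \<Longrightarrow> ((\<lambda>r. exp (- l * r) *\<^sub>R H r s) has_integral g s) {0..};
        ((\<lambda>s. exp (- l * s) *\<^sub>R g s) has_integral I) {0..}\<rbrakk>
       \<Longrightarrow> ((\<lambda>t. exp (- l * t) *\<^sub>R integral {0..t} (\<lambda>s. H (t - s) s)) has_integral I) {0..}"
      (is "\<lbrakk>_; PROP ?C; _\<rbrakk> \<Longrightarrow> ?D")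
proof -
  define G where "G l r s = exp (- l * (r + s)) *\<^sub>R H r s" for l r s
  have kernel: "decaying_kernel (G l) M (l - w)" if "l > w" for l
  proof
    show "continuous_on ({0<..} \<times> {0<..}) (\<lambda>(r, s). G l r s)"
      unfolding G_def case_prod_unfold
      by (intro continuous_intros cont[unfolded case_prod_unfold])
    fix r s :: real assume "r > 0" "s > 0"
    from mult_left_mono[OF bound[OF this], of "exp (- l * (r + s))"]
    show "norm (G l r s) \<le> M * exp (- (l - w) * (r + s))"
      by (simp add: G_def mult.left_commute[of _ M] exp_add[symmetric] algebra_simps)
  qed (use that in simp)
  have conv_eq: "decaying_kernel.convolution (G l) t = exp (- l * t) *\<^sub>R integral {0..t} (\<lambda>s. H (t - s) s)"
    if "l > w" for l t
    unfolding decaying_kernel.convolution_def[OF kernel[OF that]] G_def by simp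
  have conv_eq': "integral {0..t} (\<lambda>s. H (t - s) s) = exp ((w + 1) * t) *\<^sub>R decaying_kernel.convolution (G (w + 1)) t" for t
  proof -
    have "exp ((w + 1) * t) * exp (- (w + 1) * t) = 1"
      unfolding exp_add[symmetric] by (simp add: algebra_simps)
    then show ?thesis by (subst conv_eq) simp_all
  qed
  interpret k: decaying_kernel "G (w + 1)" M "w + 1 - w" by (rule kernel) simp
  show ?A unfolding conv_eq' by (intro continuous_intros k.continuous_on_convolution)
  show ?B if "t > 0"
  proof -
    have "norm (integral {0..t} (\<lambda>s. H (t - s) s)) \<le> exp ((w + 1) * t) * (M * t * exp (- (w + 1 - w) * t))"
      unfolding conv_eq' norm_scaleR using k.norm_convolution[of t] that by simp
    also have "\<dots> = M * t * (exp ((w + 1) * t) * exp (- (w + 1 - w) * t))" by simp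
    also have "exp ((w + 1) * t) * exp (- (w + 1 - w) * t) = exp (w * t)"
      unfolding exp_add[symmetric] by (simp add: algebra_simps)
    finally show ?thesis .
  qed
  show ?D if l: "l > w" and g: "PROP ?C" and I: "((\<lambda>s. exp (- l * s) *\<^sub>R g s) has_integral I) {0..}"
  proof -
    interpret kl: decaying_kernel "G l" M "l - w" by (rule kernel[OF l])
    have "((\<lambda>r. G l r s) has_integral exp (- l * s) *\<^sub>R g s) {0..}" if "s > 0" for s
    proof -
      have "((\<lambda>r. exp (- l * s) *\<^sub>R (exp (- l * r) *\<^sub>R H r s)) has_integral exp (- l * s) *\<^sub>R g s) {0..}"
        by (intro has_integral_cmul g that)
      moreover have "exp (- l * s) *\<^sub>R (exp (- l * r) *\<^sub>R H r s) = G l r s" for r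
        unfolding G_def scaleR_scaleR exp_add[symmetric] by (simp add: algebra_simps)
      ultimately show ?thesis by simp
    qed
    from kl.has_integral_convolution[OF this I] show ?thesis unfolding conv_eq[OF l] .
  qed
qed

section \<open>Differentiation of the Laplace transform\<close>

text \<open>With \<open>y = h * t\<close> this is
  \<open>1 - y \<le> exp (- y) \<le> 1 - y + y\<^sup>2 / 2\<close>, divided by
  \<open>h\<close>.\<close>

lemma abs_exp_quotient_diff_le:
  fixes t h :: real
  assumes "t \<ge> 0" "h > 0"
  shows "\<bar>(1 - exp (- h * t)) / h - t\<bar> \<le> h * t\<^sup>2 / 2"
proof -
  define y where "y = h * t"
  have y: "y \<ge> 0" using assms by (simp add: y_def)
  have "1 + (- y) \<le> exp (- y)" by (rule exp_ge_add_one_self)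
  moreover have "exp (- y) \<le> 1 - y + y\<^sup>2 / 2"
  proof -
    have pos: "1 - y + y\<^sup>2 / 2 > 0"
    proof -
      have "0 < ((y - 1)\<^sup>2 + 1) / 2" by (simp add: add_nonneg_pos)
      then show ?thesis by (simp add: power2_eq_square algebra_simps)
    qed
    \<comment> \<open>The product equals \<open>1 + y ^ 4 / 4\<close>, so the lower Taylor bound for
      \<open>exp y\<close> turns into an upper bound for \<open>exp (- y)\<close>.\<close>
    have "1 \<le> (1 - y + y\<^sup>2 / 2) * (1 + y + y\<^sup>2 / 2)"
      using zero_le_power[OF y, of 4] by (simp add: power2_eq_square eval_nat_numeral algebra_simps)
    also have "\<dots> \<le> (1 - y + y\<^sup>2 / 2) * exp y"
      using pos exp_lower_Taylor_quadratic[OF y] by (intro mult_left_mono) auto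
    finally show ?thesis by (simp add: exp_minus field_simps)
  qed
  ultimately have "\<bar>1 - exp (- y) - y\<bar> \<le> y\<^sup>2 / 2" by (simp add: abs_le_iff)
  moreover have "(1 - exp (- h * t)) / h - t = (1 - exp (- y) - y) / h"
    using assms by (simp add: y_def field_simps)
  ultimately have "\<bar>(1 - exp (- h * t)) / h - t\<bar> = \<bar>1 - exp (- y) - y\<bar> / h"
    "\<bar>1 - exp (- y) - y\<bar> / h \<le> y\<^sup>2 / 2 / h"
    using assms by (simp_all only: abs_divide abs_of_pos divide_right_mono less_imp_le)
  then show ?thesis using assms by (simp add: y_def power2_eq_square mult_ac)
qed

text \<open>The quadratic estimate for the exponential quotient gives an error linear in
  \<open>h\<close>, in place of differentiating under the integral. A weight
  \<open>exp (- l * t)\<close> can be put into \<open>f\<close>, so the shift 0 is no restriction.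
  One-sided limits suffice because \<open>J\<close> exists as an integral and only has to be
  identified.\<close>

lemma laplace_derivative:
  fixes f :: "real \<Rightarrow> 'a::banach"
  assumes cont: "continuous_on {0<..} f" and d: "d > 0"
    and bound: "\<And>t. t > 0 \<Longrightarrow> norm (f t) \<le> M * exp (- d * t)"
    and F: "\<And>h. h \<ge> 0 \<Longrightarrow> ((\<lambda>t. exp (- h * t) *\<^sub>R f t) has_integral F h) {0..}"
  obtains J where "((\<lambda>t. t *\<^sub>R f t) has_integral J) {0..}"
    and "((\<lambda>h. (F 0 - F h) /\<^sub>R h) \<longlongrightarrow> J) (at_right 0)"
    and "(F \<longlongrightarrow> F 0) (at_right 0)"
proof -
  have M: "M \<ge> 0" using order_trans[OF norm_ge_zero bound[of 1]] by (simp add: zero_le_mult_iff)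
  \<comment> \<open>A quarter of the decay rate absorbs one factor \<open>t\<close>, a half absorbs
    \<open>t\<^sup>2\<close>, and what remains is integrable.\<close>
  have t_le: "t \<le> 4 / d * exp (d / 4 * t)" for t
    using exp_ge_add_one_self[of "d / 4 * t"] d by (simp add: field_simps)
  have t2_le: "t\<^sup>2 \<le> 16 / d\<^sup>2 * exp (d / 2 * t)" if "t \<ge> 0" for t
  proof -
    have "t\<^sup>2 \<le> (4 / d * exp (d / 4 * t))\<^sup>2" using t_le that by (intro power_mono) auto
    also have "\<dots> = 16 / d\<^sup>2 * (exp (d / 4 * t) * exp (d / 4 * t))" by (simp add: power2_eq_square)
    also have "exp (d / 4 * t) * exp (d / 4 * t) = exp (d / 2 * t)"
      unfolding exp_add[symmetric] by (simp add: field_simps)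
    finally show ?thesis .
  qed
  define J where "J = integral {0..} (\<lambda>t. t *\<^sub>R f t)"
  have int: "(\<lambda>t. t *\<^sub>R f t) integrable_on {0..}"
  proof (rule integrable_exp_decay[where d = "3 * d / 4" and M = "4 / d * M"])
    show "continuous_on {0<..} (\<lambda>t. t *\<^sub>R f t)" by (intro continuous_intros cont)
    fix t :: real assume t: "t > 0"
    have "norm (t *\<^sub>R f t) \<le> (4 / d * exp (d / 4 * t)) * (M * exp (- d * t))"
      unfolding norm_scaleR using t_le[of t] bound[OF t] t d by (intro mult_mono) auto
    also have "\<dots> = 4 / d * M * (exp (d / 4 * t) * exp (- d * t))" by simp
    also have "exp (d / 4 * t) * exp (- d * t) = exp (- (3 * d / 4) * t)"
      unfolding exp_add[symmetric] by (simp add: field_simps)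
    finally show "norm (t *\<^sub>R f t) \<le> 4 / d * M * exp (- (3 * d / 4) * t)" .
  qed (use d in simp)
  define C where "C = 16 / d\<^sup>2 * M / 2"
  have expint: "((\<lambda>t. C * exp (- (d / 2) * t)) has_integral C * (2 / d)) {0..}"
    using has_integral_exp_minus_to_infinity[of "d / 2" 0] d by (intro has_integral_mult_right) simp
  have diff: "norm ((F 0 - F h) /\<^sub>R h - J) \<le> h * (C * (2 / d))" if h: "h > 0" for h
  proof -
    have eq: "((\<lambda>t. (f t - exp (- h * t) *\<^sub>R f t) /\<^sub>R h - t *\<^sub>R f t) has_integral (F 0 - F h) /\<^sub>R h - J) {0..}"
      unfolding J_def
      using F[of 0] F[of h] h by (intro has_integral_diff has_integral_cmul integrable_integral int) auto
    have "norm (integral {0..} (\<lambda>t. (f t - exp (- h * t) *\<^sub>R f t) /\<^sub>R h - t *\<^sub>R f t)) \<le>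
        integral {0..} (\<lambda>t. h * (C * exp (- (d / 2) * t)))"
    proof (rule integral_norm_bound_integral_spike_finite[where F = "{0}"])
      fix t :: real assume "t \<in> {0..} - {0}"
      then have t: "t > 0" by auto
      have "(f t - exp (- h * t) *\<^sub>R f t) /\<^sub>R h - t *\<^sub>R f t = ((1 - exp (- h * t)) / h - t) *\<^sub>R f t"
        by (simp add: algebra_simps divide_inverse)
      then have "norm ((f t - exp (- h * t) *\<^sub>R f t) /\<^sub>R h - t *\<^sub>R f t) = \<bar>(1 - exp (- h * t)) / h - t\<bar> * norm (f t)"
        by simp
      also have "\<dots> \<le> (h * (16 / d\<^sup>2 * exp (d / 2 * t)) / 2) * (M * exp (- d * t))"
      proof (intro mult_mono bound t)
        have "h * t\<^sup>2 \<le> h * (16 / d\<^sup>2 * exp (d / 2 * t))" using h t2_le t by (intro mult_left_mono) auto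
        then show "\<bar>(1 - exp (- h * t)) / h - t\<bar> \<le> h * (16 / d\<^sup>2 * exp (d / 2 * t)) / 2"
          by (intro order_trans[OF abs_exp_quotient_diff_le] divide_right_mono) (use t h in auto)
      qed (use h in auto)
      also have "\<dots> = h * (C * (exp (d / 2 * t) * exp (- d * t)))" by (simp add: C_def)
      also have "exp (d / 2 * t) * exp (- d * t) = exp (- (d / 2) * t)"
        unfolding exp_add[symmetric] by (simp add: field_simps)
      finally show "norm ((f t - exp (- h * t) *\<^sub>R f t) /\<^sub>R h - t *\<^sub>R f t) \<le> h * (C * exp (- (d / 2) * t))" .
    qed (use has_integral_integrable[OF eq] has_integral_integrable[OF expint]
        in \<open>auto intro: integrable_on_mult_right\<close>)
    also have "integral {0..} (\<lambda>t. h * (C * exp (- (d / 2) * t))) = h * (C * (2 / d))"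
      by (intro integral_unique has_integral_mult_right expint)
    finally show ?thesis unfolding integral_unique[OF eq] .
  qed
  have "((\<lambda>h. (F 0 - F h) /\<^sub>R h - J) \<longlongrightarrow> 0) (at_right 0)"
  proof (rule Lim_null_comparison)
    show "\<forall>\<^sub>F h in at_right 0. norm ((F 0 - F h) /\<^sub>R h - J) \<le> h * (C * (2 / d))"
      using diff by (auto simp: eventually_at_filter)
    show "((\<lambda>h. h * (C * (2 / d))) \<longlongrightarrow> 0) (at_right 0)"
      by (rule tendsto_mult_left_zero) (rule tendsto_ident_at)
  qed
  then have lim: "((\<lambda>h. (F 0 - F h) /\<^sub>R h) \<longlongrightarrow> J) (at_right 0)"
    by (simp add: LIM_zero_iff)
  \<comment> \<open>Continuity is a by-product: \<open>F h\<close> is \<open>F 0\<close> minus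
    \<open>h\<close> times a convergent quotient.\<close>
  have "((\<lambda>h. F 0 - h *\<^sub>R ((F 0 - F h) /\<^sub>R h)) \<longlongrightarrow> F 0 - 0 *\<^sub>R J) (at_right 0)"
    by (intro tendsto_intros lim)
  then have "((\<lambda>h. F 0 - h *\<^sub>R ((F 0 - F h) /\<^sub>R h)) \<longlongrightarrow> F 0) (at_right 0)" by simp
  moreover have "\<forall>\<^sub>F h in at_right 0. F 0 - h *\<^sub>R ((F 0 - F h) /\<^sub>R h) = F h"
    by (auto simp: eventually_at_filter)
  ultimately have "(F \<longlongrightarrow> F 0) (at_right 0)" by (rule Lim_transform_eventually)
  with lim that integrable_integral[OF int] show thesis by (simp add: J_def)
qed

section \<open>Resolvent families\<close>

lemma resolvent_op_bounded_clinear: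
  "\<mu> \<in> resolvent_set D A \<Longrightarrow> bounded_clinear (resolvent_op D A \<mu>)"
  by (simp add: resolvent_set_def)

text \<open>Apply the resolvent at \<open>b\<close> to \<open>x = (b - A) y + (a - b) y\<close>,
  where \<open>y\<close> is the resolvent at \<open>a\<close> applied to \<open>x\<close>. This
  order keeps the inner vector fixed as \<open>b\<close> tends to \<open>a\<close>, so that strong
  continuity in \<open>b\<close> is enough later.\<close>

lemma resolvent_identity:
  assumes a: "a \<in> resolvent_set D A" and b: "b \<in> resolvent_set D A"
  shows "resolvent_op D A b x = resolvent_op D A a x + (a - b) *\<^sub>C resolvent_op D A b (resolvent_op D A a x)"
proof -
  have bij: "bij_betw (\<lambda>x. a *\<^sub>C x - A x) D UNIV" "bij_betw (\<lambda>x. b *\<^sub>C x - A x) D UNIV"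
    and lin: "bounded_clinear (resolvent_op D A b)"
    using a b by (simp_all add: resolvent_set_def)
  define y where "y = resolvent_op D A a x"
  have y: "y \<in> D" "a *\<^sub>C y - A y = x"
    using bij(1) f_the_inv_into_f_bij_betw[OF bij(1), of x] bij_betw_the_inv_into[OF bij(1)]
    by (auto simp: y_def resolvent_op_def bij_betw_def)
  have "a *\<^sub>C y = (a - b) *\<^sub>C y + b *\<^sub>C y"
    by (subst scaleC_add_left[symmetric]) simp
  then have "x = (b *\<^sub>C y - A y) + (a - b) *\<^sub>C y" using y(2) by (simp add: algebra_simps)
  then have "resolvent_op D A b x = resolvent_op D A b (b *\<^sub>C y - A y) + resolvent_op D A b ((a - b) *\<^sub>C y)"
    using lin by (metis bounded_clinear_def bounded_linear.linear linear_add)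
  moreover have "resolvent_op D A b (b *\<^sub>C y - A y) = y"
    unfolding resolvent_op_def
    using the_inv_into_f_f[of "\<lambda>x. b *\<^sub>C x - A x" D y] bij(2) y(1) by (simp add: bij_betw_def)
  moreover have "resolvent_op D A b ((a - b) *\<^sub>C y) = (a - b) *\<^sub>C resolvent_op D A b y"
    using lin by (simp add: bounded_clinear_def)
  ultimately show ?thesis by (simp add: y_def)
qed

text \<open>The split \<open>S r (S s x - S s0 x) + S r (S s0 x)\<close> upgrades separate to joint
  continuity: local boundedness of the operators handles the first summand, strong continuity the
  second.\<close>

lemma continuous_on_operator_orbit:
  fixes S :: "real \<Rightarrow> 'a::real_normed_vector \<Rightarrow> 'a"
  assumes lin: "\<And>t. t > 0 \<Longrightarrow> bounded_linear (S t)"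
    and cont: "\<And>y. continuous_on {0<..} (\<lambda>t. S t y)"
    and bound: "\<And>t y. t > 0 \<Longrightarrow> norm (S t y) \<le> M * exp (w * t) * norm y"
  shows "continuous_on ({0<..} \<times> {0<..}) (\<lambda>(r, s). S r (S s x))"
proof -
  have "((\<lambda>z. S (fst z) (S (snd z) x)) \<longlongrightarrow> S r0 (S s0 x)) (at (r0, s0) within {0<..} \<times> {0<..})" (is "(_ \<longlongrightarrow> _) ?F")
    if "r0 > 0" "s0 > 0" for r0 s0
  proof -
    have pos: "\<forall>\<^sub>F z in ?F. fst z > 0 \<and> snd z > 0"
      by (auto simp: eventually_at_filter intro!: always_eventually)
    have fst: "(fst \<longlongrightarrow> r0) ?F" and snd: "(snd \<longlongrightarrow> s0) ?F"
      using tendsto_fst[OF tendsto_ident_at, of "(r0, s0)"] tendsto_snd[OF tendsto_ident_at, of "(r0, s0)"]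
      by auto
    have c: "isCont (\<lambda>t. S t y) t" if "t > 0" for t y
      using cont[of y] that by (simp add: continuous_on_eq_continuous_at)
    have 1: "((\<lambda>z. S (fst z) (S s0 x)) \<longlongrightarrow> S r0 (S s0 x)) ?F"
      by (rule isCont_tendsto_compose[OF c fst]) (use that in simp)
    have 2: "((\<lambda>z. S (snd z) x) \<longlongrightarrow> S s0 x) ?F"
      by (rule isCont_tendsto_compose[OF c snd]) (use that in simp)
    have 3: "((\<lambda>z. S (fst z) (S (snd z) x - S s0 x)) \<longlongrightarrow> 0) ?F"
    proof (rule Lim_null_comparison)
      show "\<forall>\<^sub>F z in ?F. norm (S (fst z) (S (snd z) x - S s0 x)) \<le> M * exp (w * fst z) * norm (S (snd z) x - S s0 x)"
        using pos by eventually_elim (auto intro: bound)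
      have "((\<lambda>z. M * exp (w * fst z) * norm (S (snd z) x - S s0 x)) \<longlongrightarrow> M * exp (w * r0) * norm (S s0 x - S s0 x)) ?F"
        by (intro tendsto_intros fst 2)
      then show "((\<lambda>z. M * exp (w * fst z) * norm (S (snd z) x - S s0 x)) \<longlongrightarrow> 0) ?F" by simp
    qed
    have "((\<lambda>z. S (fst z) (S (snd z) x - S s0 x) + S (fst z) (S s0 x)) \<longlongrightarrow> 0 + S r0 (S s0 x)) ?F"
      by (intro tendsto_add 1 3)
    then have "((\<lambda>z. S (fst z) (S (snd z) x - S s0 x) + S (fst z) (S s0 x)) \<longlongrightarrow> S r0 (S s0 x)) ?F" by simp
    moreover have "\<forall>\<^sub>F z in ?F. S (fst z) (S (snd z) x - S s0 x) + S (fst z) (S s0 x) = S (fst z) (S (snd z) x)"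
      using pos by eventually_elim (simp add: bounded_linear.linear[OF lin] linear_diff)
    ultimately show ?thesis by (rule Lim_transform_eventually)
  qed
  then show ?thesis by (auto simp: continuous_on_def case_prod_unfold)
qed

lemma tendsto_powr_difference_quotient:
  fixes l b :: real
  assumes "l > 0"
  shows "((\<lambda>h. ((l + h) powr b - l powr b) / h) \<longlongrightarrow> b * l powr (b - 1)) (at_right 0)"
proof -
  have "((\<lambda>z. z powr b) has_real_derivative b * l powr (b - 1)) (at l)"
    using assms by (rule has_real_derivative_powr)
  then have "((\<lambda>h. ((l + h) powr b - l powr b) / h) \<longlongrightarrow> b * l powr (b - 1)) (at 0)"
    by (simp add: DERIV_def)
  then show ?thesis by (rule tendsto_mono[rotated]) (rule at_le, simp)
qed

text \<open>These are the facts about the family that the argument uses, restricted to real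
  transform parameters. The normalisation \<open>0 \<le> w \<le> \<omega>\<close> ensures that
  \<open>l > \<omega>\<close> gives both \<open>l > 0\<close> and decay of the weighted
  orbit.\<close>

locale resolvent_orbit =
  fixes \<alpha> M w \<omega> :: real and D :: "'a::complex_banach set" and A :: "'a \<Rightarrow> 'a" and S :: "real \<Rightarrow> 'a \<Rightarrow> 'a"
  assumes w: "0 \<le> w" "w \<le> \<omega>"
    and lin: "\<And>t. t > 0 \<Longrightarrow> bounded_linear (S t)"
    and cont: "\<And>y. continuous_on {0<..} (\<lambda>t. S t y)"
    and bound: "\<And>t y. t > 0 \<Longrightarrow> norm (S t y) \<le> M * exp (w * t) * norm y"
    and S0: "\<And>y. S 0 y = y"
    and res: "\<And>l. l > \<omega> \<Longrightarrow> complex_of_real (l powr \<alpha>) \<in> resolvent_set D A"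
    and lap: "\<And>l y. l > \<omega> \<Longrightarrow> ((\<lambda>t. exp (- l * t) *\<^sub>R S t y) has_integral
      l powr (\<alpha> - 1) *\<^sub>R resolvent_op D A (complex_of_real (l powr \<alpha>)) y) {0..}"
begin

definition R :: "real \<Rightarrow> 'a \<Rightarrow> 'a" where "R l = resolvent_op D A (complex_of_real (l powr \<alpha>))"
definition L :: "real \<Rightarrow> 'a \<Rightarrow> 'a" where "L l y = l powr (\<alpha> - 1) *\<^sub>R R l y"

lemma M_nonneg: "M \<ge> 0" if "(x::'a) \<noteq> 0"
proof -
  have "0 \<le> M * (exp (w * 1) * norm x)" using order_trans[OF norm_ge_zero bound[of 1 x]] by simp
  moreover have "exp (w * 1) * norm x > 0" using that by simp
  ultimately show ?thesis by (meson linorder_not_le mult_neg_pos)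
qed

lemma lap_L: "l > \<omega> \<Longrightarrow> ((\<lambda>t. exp (- l * t) *\<^sub>R S t y) has_integral L l y) {0..}"
  unfolding L_def R_def by (rule lap)

lemma bounded_linear_L: "l > \<omega> \<Longrightarrow> bounded_linear (L l)"
  unfolding L_def R_def using resolvent_op_bounded_clinear[OF res]
  by (auto simp: bounded_clinear_def intro!: bounded_linear_compose[OF bounded_linear_scaleR_right])

lemma R_identity:
  assumes "l > \<omega>" "m > \<omega>"
  shows "R m x = R l x + (l powr \<alpha> - m powr \<alpha>) *\<^sub>R R m (R l x)"
  unfolding R_def using resolvent_identity[OF res[OF assms(1)] res[OF assms(2)], of x]
  by (simp add: scaleR_scaleC)

lemma laplace_weighted_orbit:
  assumes l: "l > \<omega>"
  shows "((\<lambda>t. exp (- l * t) *\<^sub>R (t *\<^sub>R S t x)) has_integral ((1 - \<alpha>) / l) *\<^sub>R L l x + \<alpha> *\<^sub>R L l (L l x)) {0..}"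
proof -
  have l0: "l > 0" using l w by simp
  \<comment> \<open>This is used for two vectors: for \<open>x\<close> it supplies the limit of the
    quotient, for \<open>R l x\<close> the right continuity of \<open>L (l + h) (R l x)\<close> at
    \<open>h = 0\<close>.\<close>
  have shift: "\<exists>J. ((\<lambda>t. t *\<^sub>R (exp (- l * t) *\<^sub>R S t y)) has_integral J) {0..} \<and>
    ((\<lambda>h. (L l y - L (l + h) y) /\<^sub>R h) \<longlongrightarrow> J) (at_right 0) \<and>
    ((\<lambda>h. L (l + h) y) \<longlongrightarrow> L l y) (at_right 0)" for y
  proof -
    obtain J where "((\<lambda>t. t *\<^sub>R (exp (- l * t) *\<^sub>R S t y)) has_integral J) {0..}"
      "((\<lambda>h. (L (l + 0) y - L (l + h) y) /\<^sub>R h) \<longlongrightarrow> J) (at_right 0)"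
      "((\<lambda>h. L (l + h) y) \<longlongrightarrow> L (l + 0) y) (at_right 0)"
    proof (rule laplace_derivative)
      show "continuous_on {0<..} (\<lambda>t. exp (- l * t) *\<^sub>R S t y)" by (intro continuous_intros cont)
      show "l - w > 0" using l w by simp
      show "norm (exp (- l * t) *\<^sub>R S t y) \<le> (M * norm y) * exp (- (l - w) * t)" if "t > 0" for t
      proof -
        have "norm (exp (- l * t) *\<^sub>R S t y) \<le> exp (- l * t) * (M * exp (w * t) * norm y)"
          using bound[OF that, of y] by simp
        also have "\<dots> = (M * norm y) * (exp (- l * t) * exp (w * t))" by simp
        also have "exp (- l * t) * exp (w * t) = exp (- (l - w) * t)"
          unfolding exp_add[symmetric] by (simp add: algebra_simps)
        finally show ?thesis .
      qed
      show "((\<lambda>t. exp (- h * t) *\<^sub>R (exp (- l * t) *\<^sub>R S t y)) has_integral L (l + h) y) {0..}" if "h \<ge> 0" for h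
      proof -
        have "exp (- h * t) *\<^sub>R (exp (- l * t) *\<^sub>R S t y) = exp (- (l + h) * t) *\<^sub>R S t y" for t
          unfolding scaleR_scaleR exp_add[symmetric] by (simp add: algebra_simps)
        moreover have "l + h > \<omega>" using l that by simp
        ultimately show ?thesis using lap_L[of "l + h" y] by (simp only:)
      qed
    qed
    then show ?thesis by auto
  qed
  obtain J where J: "((\<lambda>t. t *\<^sub>R (exp (- l * t) *\<^sub>R S t x)) has_integral J) {0..}"
    and lim: "((\<lambda>h. (L l x - L (l + h) x) /\<^sub>R h) \<longlongrightarrow> J) (at_right 0)"
    using shift[of x] by blast
  \<comment> \<open>This is the quotient after the resolvent identity, in product-rule form. The
    power of \<open>l + h\<close> stays inside \<open>L (l + h)\<close>, so the limit of each factor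
    is known.\<close>
  have lim': "((\<lambda>h. - (((l + h) powr (\<alpha> - 1) - l powr (\<alpha> - 1)) / h) *\<^sub>R R l x +
      (((l + h) powr \<alpha> - l powr \<alpha>) / h) *\<^sub>R L (l + h) (R l x)) \<longlongrightarrow>
      - ((\<alpha> - 1) * l powr (\<alpha> - 1 - 1)) *\<^sub>R R l x + (\<alpha> * l powr (\<alpha> - 1)) *\<^sub>R L l (R l x)) (at_right 0)"
    using shift[of "R l x"] by (intro tendsto_intros tendsto_powr_difference_quotient l0) blast
  have "- (((l + h) powr (\<alpha> - 1) - l powr (\<alpha> - 1)) / h) *\<^sub>R R l x +
      (((l + h) powr \<alpha> - l powr \<alpha>) / h) *\<^sub>R L (l + h) (R l x) = (L l x - L (l + h) x) /\<^sub>R h" if "h > 0" for h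
  proof -
    define Z where "Z = R (l + h) (R l x)"
    have R_l: "R l x = R (l + h) x + ((l + h) powr \<alpha> - l powr \<alpha>) *\<^sub>R Z"
      using R_identity[of l "l + h" x] l that by (simp add: Z_def algebra_simps)
    show ?thesis
      unfolding L_def
      \<comment> \<open>Hiding the composed term first keeps the next rewrite away from the
        \<open>R l x\<close> inside it.\<close>
      unfolding Z_def[symmetric]
      unfolding R_l by (simp add: algebra_simps divide_inverse)
  qed
  then have "\<forall>\<^sub>F h in at_right 0. - (((l + h) powr (\<alpha> - 1) - l powr (\<alpha> - 1)) / h) *\<^sub>R R l x +
      (((l + h) powr \<alpha> - l powr \<alpha>) / h) *\<^sub>R L (l + h) (R l x) = (L l x - L (l + h) x) /\<^sub>R h"
    by (auto simp: eventually_at_filter)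
  from tendsto_unique[OF trivial_limit_at_right_real lim Lim_transform_eventually[OF lim' this]]
  have "J = - ((\<alpha> - 1) * l powr (\<alpha> - 1 - 1)) *\<^sub>R R l x + (\<alpha> * l powr (\<alpha> - 1)) *\<^sub>R L l (R l x)" .
  also have "l powr (\<alpha> - 1 - 1) = l powr (\<alpha> - 1) / l" using l0 by (simp add: powr_diff power2_eq_square)
  also have "(\<alpha> * l powr (\<alpha> - 1)) *\<^sub>R L l (R l x) = \<alpha> *\<^sub>R L l (L l x)"
    using linear_scale[OF bounded_linear.linear[OF bounded_linear_L[OF l]]] by (simp add: L_def)
  also have "- ((\<alpha> - 1) * (l powr (\<alpha> - 1) / l)) *\<^sub>R R l x = ((1 - \<alpha>) / l) *\<^sub>R L l x"
    by (simp add: L_def algebra_simps divide_inverse)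
  finally have "J = ((1 - \<alpha>) / l) *\<^sub>R L l x + \<alpha> *\<^sub>R L l (L l x)" .
  then show ?thesis using J by (simp add: mult.commute)
qed

lemma orbit_convolution_identity:
  assumes t: "t > 0"
  shows "t *\<^sub>R S t x = (1 - \<alpha>) *\<^sub>R integral {0..t} (\<lambda>s. S s x) + \<alpha> *\<^sub>R integral {0..t} (\<lambda>s. S (t - s) (S s x))"
\<comment> \<open>The sign of \<open>M\<close> can only be read off from a nonzero vector.\<close>
proof (cases "x = 0")
  case True
  have zero: "S s 0 = 0" if "s \<ge> 0" for s
    using that S0 linear_0[OF bounded_linear.linear[OF lin]] by (cases "s = 0") auto
  then have "integral {0..t} (\<lambda>s. S s 0) = integral {0..t} (\<lambda>s. 0)"
    "integral {0..t} (\<lambda>s. S (t - s) (S s 0)) = integral {0..t} (\<lambda>s. 0)"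
    using zero by (intro integral_cong; simp)+
  then show ?thesis using True zero t by simp
next
  case False
  note M = M_nonneg[OF False]
  define N where "N = max (M * norm x) (M * (M * norm x))"
  have N: "N \<ge> 0" "M * norm x \<le> N" "M * (M * norm x) \<le> N" using M by (auto simp: N_def le_max_iff_disj)
  have bound_x: "norm (S s x) \<le> M * norm x * exp (w * s)" if "s > 0" for s
    using bound[OF that, of x] by (simp add: mult_ac)
  \<comment> \<open>The integral of the orbit is treated as a convolution whose kernel is constant
    in \<open>r\<close>, so the same results, with the common constant \<open>N\<close>, serve both
    terms.\<close>
  let ?K = "\<lambda>t. integral {0..t} (\<lambda>s. S s x)" and ?P = "\<lambda>t. integral {0..t} (\<lambda>s. S (t - s) (S s x))"
  have contK: "continuous_on ({0<..} \<times> {0<..}) (\<lambda>(r, s). S s x)"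
    unfolding case_prod_unfold
    by (rule continuous_on_compose2[OF cont[of x] continuous_on_snd[OF continuous_on_id]]) auto
  have boundK: "norm (S s x) \<le> N * exp (w * (r + s))" if "r > 0" "s > 0" for r s
  proof -
    have "w * s \<le> w * (r + s)" using that w by (intro mult_left_mono) auto
    then have "M * norm x * exp (w * s) \<le> N * exp (w * (r + s))" using N by (intro mult_mono) auto
    then show ?thesis using bound_x[OF that(2)] by simp
  qed
  have contP: "continuous_on ({0<..} \<times> {0<..}) (\<lambda>(r, s). S r (S s x))"
    by (rule continuous_on_operator_orbit[OF lin cont bound])
  have boundP: "norm (S r (S s x)) \<le> N * exp (w * (r + s))" if "r > 0" "s > 0" for r s
  proof -
    have "norm (S r (S s x)) \<le> M * exp (w * r) * norm (S s x)" by (rule bound[OF that(1)])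
    also have "\<dots> \<le> M * exp (w * r) * (M * norm x * exp (w * s))"
      using M bound_x[OF that(2)] by (intro mult_left_mono) auto
    also have "\<dots> = M * (M * norm x) * exp (w * (r + s))" by (simp add: exp_add algebra_simps)
    also have "\<dots> \<le> N * exp (w * (r + s))" using N by (intro mult_right_mono) auto
    finally show ?thesis .
  qed
  have lapK: "((\<lambda>t. exp (- l * t) *\<^sub>R ?K t) has_integral (1 / l) *\<^sub>R L l x) {0..}" if l: "l > \<omega>" for l
  proof (rule laplace_convolution[OF contK boundK])
    show "l > w" using l w by simp
    have l0: "l > 0" using l w by simp
    show "((\<lambda>r. exp (- l * r) *\<^sub>R S s x) has_integral (1 / l) *\<^sub>R S s x) {0..}" for s
      using has_integral_exp_minus_to_infinity[OF l0, of 0] by (intro has_integral_scaleR_left) simp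
    show "((\<lambda>s. exp (- l * s) *\<^sub>R ((1 / l) *\<^sub>R S s x)) has_integral (1 / l) *\<^sub>R L l x) {0..}"
      using has_integral_cmul[OF lap_L[OF l, of x], of "1 / l"] by (simp add: mult.commute)
  qed
  have lapP: "((\<lambda>t. exp (- l * t) *\<^sub>R ?P t) has_integral L l (L l x)) {0..}" if l: "l > \<omega>" for l
  proof (rule laplace_convolution[OF contP boundP])
    show "l > w" using l w by simp
    show "((\<lambda>r. exp (- l * r) *\<^sub>R S r (S s x)) has_integral L l (S s x)) {0..}" for s
      by (rule lap_L[OF l])
    \<comment> \<open>The inner transform of \<open>S r (S s x)\<close> is
      \<open>L l (S s x)\<close>. Pulling the bounded operator \<open>L l\<close> out of the
      integral over \<open>s\<close> produces its square.\<close>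
    have "((\<lambda>s. L l (exp (- l * s) *\<^sub>R S s x)) has_integral L l (L l x)) {0..}"
      using has_integral_linear[OF lap_L[OF l, of x] bounded_linear_L[OF l]] by (simp add: o_def)
    then show "((\<lambda>s. exp (- l * s) *\<^sub>R L l (S s x)) has_integral L l (L l x)) {0..}"
      by (simp add: linear_scale[OF bounded_linear.linear[OF bounded_linear_L[OF l]]])
  qed
  define h where "h t = t *\<^sub>R S t x - (1 - \<alpha>) *\<^sub>R ?K t - \<alpha> *\<^sub>R ?P t" for t
  have "h t = 0"
  proof (rule laplace_unique[OF _ _ _ t])
    show "continuous_on {0<..} h"
      unfolding h_def
      by (intro continuous_intros cont continuous_on_convolution[OF contK boundK]
          continuous_on_convolution[OF contP boundP])
    \<comment> \<open>The rate \<open>w + 1\<close> pays for the factor \<open>t\<close> through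
      \<open>t \<le> exp t\<close>.\<close>
    show "norm (h t) \<le> ((1 + \<bar>1 - \<alpha>\<bar> + \<bar>\<alpha>\<bar>) * N) * exp ((w + 1) * t)" if t: "t > 0" for t
    proof -
      have 1: "norm (t *\<^sub>R S t x) \<le> N * t * exp (w * t)"
      proof -
        have "norm (S t x) \<le> N * exp (w * t)"
          by (rule order_trans[OF bound_x[OF t]]) (intro mult_right_mono N, simp)
        then show ?thesis using mult_left_mono[of "norm (S t x)" "N * exp (w * t)" t] t by (simp add: mult_ac)
      qed
      have 2: "norm ((1 - \<alpha>) *\<^sub>R ?K t) \<le> \<bar>1 - \<alpha>\<bar> * (N * t * exp (w * t))"
        unfolding norm_scaleR by (intro mult_left_mono norm_convolution_le[OF contK boundK] t) auto
      have 3: "norm (\<alpha> *\<^sub>R ?P t) \<le> \<bar>\<alpha>\<bar> * (N * t * exp (w * t))"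
        unfolding norm_scaleR by (intro mult_left_mono norm_convolution_le[OF contP boundP] t) auto
      have "norm (h t) \<le> norm (t *\<^sub>R S t x) + norm ((1 - \<alpha>) *\<^sub>R ?K t) + norm (\<alpha> *\<^sub>R ?P t)"
        unfolding h_def by (rule order_trans[OF norm_triangle_ineq4 add_right_mono[OF norm_triangle_ineq4]])
      also have "\<dots> \<le> (1 + \<bar>1 - \<alpha>\<bar> + \<bar>\<alpha>\<bar>) * (N * t * exp (w * t))"
        using 1 2 3 by (simp add: distrib_right)
      also have "\<dots> \<le> (1 + \<bar>1 - \<alpha>\<bar> + \<bar>\<alpha>\<bar>) * (N * exp ((w + 1) * t))"
      proof (intro mult_left_mono)
        have "t \<le> exp t" using exp_ge_add_one_self[of t] by linarith
        then have "N * (t * exp (w * t)) \<le> N * (exp t * exp (w * t))"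
          using N by (intro mult_left_mono mult_right_mono) auto
        then show "N * t * exp (w * t) \<le> N * exp ((w + 1) * t)"
          by (simp add: exp_add[symmetric] algebra_simps)
      qed auto
      finally show ?thesis by (simp add: mult.assoc)
    qed
    show "((\<lambda>t. exp (- l * t) *\<^sub>R h t) has_integral 0) {0..}" if l: "l > \<omega>" for l
    proof -
      have "((\<lambda>t. exp (- l * t) *\<^sub>R (t *\<^sub>R S t x) - (1 - \<alpha>) *\<^sub>R (exp (- l * t) *\<^sub>R ?K t) - \<alpha> *\<^sub>R (exp (- l * t) *\<^sub>R ?P t))
        has_integral (((1 - \<alpha>) / l) *\<^sub>R L l x + \<alpha> *\<^sub>R L l (L l x)) - (1 - \<alpha>) *\<^sub>R ((1 / l) *\<^sub>R L l x) - \<alpha> *\<^sub>R L l (L l x)) {0..}"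
        by (intro has_integral_diff has_integral_cmul lapK lapP laplace_weighted_orbit l)
      then show ?thesis by (simp add: h_def scaleR_diff_right mult.commute mult.left_commute)
    qed
  qed
  then show ?thesis by (simp add: h_def algebra_simps)
qed

end

section \<open>Passage from the complex definition to the real axis, and the theorem\<close>

lemma resolvent_family_orbit:
  fixes S :: "real \<Rightarrow> 'a \<Rightarrow> 'a::complex_banach"
  assumes "resolvent_family \<alpha> 1 D A S"
  obtains M w \<omega> where "resolvent_orbit \<alpha> M w \<omega> D A S"
proof -
  obtain M w0 \<omega>0 where M: "M > 0" "\<And>t. t > 0 \<Longrightarrow> onorm (S t) \<le> M * exp (w0 * t)"
    and clin: "\<And>t. t > 0 \<Longrightarrow> bounded_clinear (S t)"
    and cont: "\<And>y. continuous_on {0<..} (\<lambda>t. S t y)"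
    and S0: "\<And>y. S 0 y = y"
    and \<omega>0: "\<omega>0 \<ge> 0" "(\<lambda>z. z powr complex_of_real \<alpha>) ` {z. Re z > \<omega>0} \<subseteq> resolvent_set D A"
    and lap: "\<And>x z. Re z > \<omega>0 \<Longrightarrow> ((\<lambda>t. exp (- z * complex_of_real t) *\<^sub>C S t x) has_integral
             z powr complex_of_real (\<alpha> - 1) *\<^sub>C resolvent_op D A (z powr complex_of_real \<alpha>) x) {0..}"
    using assms unfolding resolvent_family_def by (auto simp del: of_real_diff)
  \<comment> \<open>The growth bound survives a larger rate, and the Laplace formula holds on the
    smaller half-plane, so both constants may be enlarged to meet the normalisation.\<close>
  define w where "w = max w0 0"
  define \<omega> where "\<omega> = max \<omega>0 w"
  have "resolvent_orbit \<alpha> M w \<omega> D A S"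
  proof (rule resolvent_orbit.intro)
    show "0 \<le> w" "w \<le> \<omega>" by (auto simp: w_def \<omega>_def)
    show lin: "bounded_linear (S t)" if "t > 0" for t
      using clin[OF that] by (simp add: bounded_clinear_def)
    show "norm (S t y) \<le> M * exp (w * t) * norm y" if t: "t > 0" for t y
    proof -
      have "norm (S t y) \<le> onorm (S t) * norm y" by (rule onorm[OF lin[OF t]])
      also have "\<dots> \<le> M * exp (w0 * t) * norm y" using M(2)[OF t] by (rule mult_right_mono) simp
      also have "\<dots> \<le> M * exp (w * t) * norm y"
        using M(1) t by (intro mult_right_mono mult_left_mono) (auto simp: w_def)
      finally show ?thesis .
    qed
    fix l assume l: "l > \<omega>"
    then have l0: "l > 0" "l > \<omega>0" using \<omega>0 by (auto simp: \<omega>_def)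
    have powr: "complex_of_real l powr complex_of_real b = complex_of_real (l powr b)" for b
      using l0 by (intro powr_of_real) simp
    show "complex_of_real (l powr \<alpha>) \<in> resolvent_set D A"
      using \<omega>0(2) l0 by (auto simp: powr[symmetric])
    show "((\<lambda>t. exp (- l * t) *\<^sub>R S t y) has_integral
      l powr (\<alpha> - 1) *\<^sub>R resolvent_op D A (complex_of_real (l powr \<alpha>)) y) {0..}" for y
      using lap[of "complex_of_real l" y] l0
      unfolding powr by (simp add: scaleR_scaleC exp_of_real[symmetric])
  qed (fact cont S0)+
  then show thesis by (rule that)
qed

lemma conv_g_kernel_1: "conv (g_kernel 1) v t = integral {0..t} v"
  unfolding conv_def g_kernel_def
  \<comment> \<open>The exceptional point is \<open>s = t\<close>, where the kernel is 0 instead of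
    1 because \<open>0 powr 0 = 0\<close>.\<close>
  by (rule integral_spike[of "{t}"]) auto

theorem theorem10:
  fixes D :: "'a::complex_banach set"
    and A :: "'a \<Rightarrow> 'a"
    and S :: "real \<Rightarrow> 'a \<Rightarrow> 'a"
    and \<alpha> T :: real
    and x :: 'a
  assumes "0 < \<alpha>" and "\<alpha> < 1"
    and "closed_linear_operator D A"
    and "resolvent_family \<alpha> 1 D A S"
    and "0 < T"
  shows "T *\<^sub>R solution S x T - conv (g_kernel 1) (solution S x) T = \<alpha> *\<^sub>R phi S T x"
proof -
  obtain M w \<omega> where "resolvent_orbit \<alpha> M w \<omega> D A S"
    using resolvent_family_orbit[OF assms(4)] .
  then interpret resolvent_orbit \<alpha> M w \<omega> D A S .
  show ?thesis
    using orbit_convolution_identity[OF \<open>0 < T\<close>, of x]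
    by (simp add: phi_def op_conv_def conv_g_kernel_1 solution_def[abs_def] algebra_simps)
qed

end
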